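(* There exist absolute constants $c$ and $c_1$ for which the following holds. Let $\mu$ be an isotropic, log-concave probability measure on $\mathbb{R}^n$, let $X_1,\dots,X_N$ be independent, distributed according to $\mu$, and let $\Gamma=\sum_{i=1}^N\langle X_i,\cdot\rangle e_i:\ell_2^n\to\ell_2^N$. Then for every convex body $K \subset \mathbb{R}^n$, $$ \mathbb{E} \left(\mathrm{diam}(K \cap \ker \Gamma) \right) \leq c_1 \inf\left\{ r >0 : \gamma_2(K \cap r S^{n-1},\psi_2)/\sqrt{N} \leq cr \right\}. $$
   Context: A symmetric probability measure $\mu$ on $\mathbb{R}^n$ is isotropic if $\int\langle x,y\rangle^2d\mu(x)=\|y\|_2^2$ for every $y$; log-concave if $\mu(\lambda A+(1-\lambda)B)\ge\mu(A)^\lambda\mu(B)^{1-\lambda}$ for all $0<\lambda<1$ and nonempty Borel $A,B$. A convex body is a compact, convex, symmetric set with nonempty interior. Diameters are Euclidean; $S^{n-1}$ is the Euclidean unit sphere. $\|f\|_{\psi_2}=\inf\{C>0:\mathbb{E}\exp(f^2/C^2)\le2\}$ w.r.t. $\mu$. For $T\subset\mathbb{R}^n$, $\gamma_2(T,\psi_2)$ is $\gamma_2$ of $\{\langle x,\cdot\rangle:x\in T\}$ with metric $\|\langle x-y,\cdot\rangle\|_{\psi_2}$, where $\gamma_2(T,d)=\inf\sup_{t\in T}\sum_{s\ge0}2^{s/2}d(t,T_s)$, infimum over families $T_s\subset T$ with $|T_0|=1$, $|T_s|\le2^{2^s}$. *)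

theory Defs
  imports "HOL-Probability.Probability"
begin

text \<open>Euclidean space R^n is represented by the extensional functions
  nat => real supported on the index set {..<n}, i.e. the carrier of the
  product measure PiM {..<n} (\<lambda>_. borel).  This allows the dimension n to be
  quantified inside the statement (the constants must be absolute).\<close>

definition Rn :: "nat \<Rightarrow> (nat \<Rightarrow> real) set" where
  "Rn n = PiE {..<n} (\<lambda>_. UNIV)"

definition Rn_borel :: "nat \<Rightarrow> (nat \<Rightarrow> real) measure" where
  "Rn_borel n = PiM {..<n} (\<lambda>_. borel)"

definition ip :: "nat \<Rightarrow> (nat \<Rightarrow> real) \<Rightarrow> (nat \<Rightarrow> real) \<Rightarrow> real" where
  "ip n x y = (\<Sum>i<n. x i * y i)"

definition enorm :: "nat \<Rightarrow> (nat \<Rightarrow> real) \<Rightarrow> real" where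
  "enorm n x = sqrt (ip n x x)"

definition edist :: "nat \<Rightarrow> (nat \<Rightarrow> real) \<Rightarrow> (nat \<Rightarrow> real) \<Rightarrow> real" where
  "edist n x y = enorm n (\<lambda>i. x i - y i)"

definition esphere :: "nat \<Rightarrow> real \<Rightarrow> (nat \<Rightarrow> real) set" where
  "esphere n r = {x \<in> Rn n. enorm n x = r}"

text \<open>Euclidean diameter (value in [0,\<infinity>]; 0 for the empty set).\<close>
definition ediam :: "nat \<Rightarrow> (nat \<Rightarrow> real) set \<Rightarrow> ennreal" where
  "ediam n S = (SUP x\<in>S. SUP y\<in>S. ennreal (edist n x y))"

definition neg_vec :: "nat \<Rightarrow> (nat \<Rightarrow> real) \<Rightarrow> (nat \<Rightarrow> real)" where
  "neg_vec n x = restrict (\<lambda>i. - x i) {..<n}"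

definition msum :: "nat \<Rightarrow> real \<Rightarrow> (nat \<Rightarrow> real) set \<Rightarrow> (nat \<Rightarrow> real) set \<Rightarrow> (nat \<Rightarrow> real) set" where
  "msum n t A B = {restrict (\<lambda>i. t * a i + (1 - t) * b i) {..<n} | a b. a \<in> A \<and> b \<in> B}"

text \<open>Outer measure (the sum of Borel sets need not be Borel).\<close>
definition outer_meas :: "'a measure \<Rightarrow> 'a set \<Rightarrow> real" where
  "outer_meas M S = Inf {measure M C | C. C \<in> sets M \<and> S \<subseteq> C}"

definition symmetric_meas :: "nat \<Rightarrow> (nat \<Rightarrow> real) measure \<Rightarrow> bool" where
  "symmetric_meas n \<mu> \<longleftrightarrow> (\<forall>A \<in> sets \<mu>. measure \<mu> (neg_vec n ` A) = measure \<mu> A)"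

definition isotropic :: "nat \<Rightarrow> (nat \<Rightarrow> real) measure \<Rightarrow> bool" where
  "isotropic n \<mu> \<longleftrightarrow> (\<forall>y \<in> Rn n. (\<integral>x. (ip n x y)\<^sup>2 \<partial>\<mu>) = (enorm n y)\<^sup>2)"

definition log_concave :: "nat \<Rightarrow> (nat \<Rightarrow> real) measure \<Rightarrow> bool" where
  "log_concave n \<mu> \<longleftrightarrow> (\<forall>t A B. 0 < t \<and> t < 1 \<and> A \<in> sets \<mu> \<and> B \<in> sets \<mu> \<and> A \<noteq> {} \<and> B \<noteq> {} \<longrightarrow>
      outer_meas \<mu> (msum n t A B) \<ge> measure \<mu> A powr t * measure \<mu> B powr (1 - t))"

definition convex_body :: "nat \<Rightarrow> (nat \<Rightarrow> real) set \<Rightarrow> bool" where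
  "convex_body n K \<longleftrightarrow> K \<subseteq> Rn n \<and> compact K
     \<and> (\<forall>x\<in>K. \<forall>y\<in>K. \<forall>t::real. 0 \<le> t \<and> t \<le> 1 \<longrightarrow> restrict (\<lambda>i. t * x i + (1 - t) * y i) {..<n} \<in> K)
     \<and> (\<forall>x\<in>K. neg_vec n x \<in> K)
     \<and> (\<exists>U. openin (top_of_set (Rn n)) U \<and> U \<noteq> {} \<and> U \<subseteq> K)"

text \<open>psi_2 norm w.r.t. mu (value \<infinity> if no admissible C exists).\<close>
definition psi2 :: "'a measure \<Rightarrow> ('a \<Rightarrow> real) \<Rightarrow> ennreal" where
  "psi2 M f = Inf {ennreal C | C. C > 0 \<and> (\<integral>\<^sup>+x. ennreal (exp ((f x)\<^sup>2 / C\<^sup>2)) \<partial>M) \<le> 2}"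

definition gamma2 :: "'a set \<Rightarrow> ('a \<Rightarrow> 'a \<Rightarrow> ennreal) \<Rightarrow> ennreal" where
  "gamma2 T d = (if T = {} then 0 else
     Inf {(SUP t\<in>T. (\<Sum>s. ennreal (2 powr (real s / 2)) * (INF u\<in>Ts s. d t u))) | Ts.
            (\<forall>s. Ts s \<subseteq> T \<and> finite (Ts s) \<and> card (Ts s) \<le> 2 ^ (2 ^ s)) \<and> card (Ts 0) = 1})"

definition psi2_dist :: "nat \<Rightarrow> (nat \<Rightarrow> real) measure \<Rightarrow> (nat \<Rightarrow> real) \<Rightarrow> (nat \<Rightarrow> real) \<Rightarrow> ennreal" where
  "psi2_dist n \<mu> x y = psi2 \<mu> (\<lambda>z. ip n (\<lambda>i. x i - y i) z)"

definition ker_Gamma :: "nat \<Rightarrow> nat \<Rightarrow> (nat \<Rightarrow> nat \<Rightarrow> real) \<Rightarrow> (nat \<Rightarrow> real) set" where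
  "ker_Gamma n N X = {y \<in> Rn n. \<forall>i<N. ip n (X i) y = 0}"

end

theory Submission
  imports Defs
begin

text \<open>
  Fix an admissible radius \<open>r\<close>. For the scales \<open>256\<^sup>l r\<close>, the probability that \<open>K \<inter> ker \<Gamma>\<close> contains a
  point of that norm is at most of order \<open>1024\<^sup>-\<^sup>l\<close>; summing over \<open>l\<close> bounds the expected diameter.
  If \<open>K\<close> reaches out to norm \<open>4 r\<close>, then the points of \<open>K\<close> of norm at most \<open>r\<close> are controlled by those of
  norm \<open>r\<close>, and convexity allows one to iterate the resulting coverings: a point of \<open>K\<close> of norm \<open>4\<^sup>j r\<close>
  is \<open>z + 2\<^sup>j w\<close> with \<open>w \<in> K\<close> of norm at most \<open>r\<close> and \<open>z\<close> in a net of size exponential in \<open>j \<epsilon> N\<close>.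
  If \<open>z + 2\<^sup>j w\<close> lies in the kernel, then \<open>|\<langle>X\<^sub>i, z\<rangle>|\<close> is much smaller than \<open>|z|\<close> for at least half of the \<open>i\<close>,
  unless \<open>|\<langle>X\<^sub>i, p\<rangle>|\<close> is large for many \<open>i\<close> and some \<open>p \<in> K\<close> of norm \<open>r\<close>. The former is excluded by a small ball
  estimate for the marginals of a log-concave measure, the latter by chaining the increments in
  \<open>\<ell>\<^sub>2\<close> with the \<open>\<psi>\<^sub>2\<close> tails, started at a level \<open>s\<close> with \<open>2\<^sup>s\<close> a small multiple of \<open>N\<close>, where
  Chebyshev's inequality suffices.
\<close>


section \<open>Euclidean norm and inner product\<close>

lemma enorm_L2: "enorm n x = L2_set x {..<n}"
  by (simp add: enorm_def ip_def L2_set_def power2_eq_square)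

lemma enorm_nonneg [simp]: "0 \<le> enorm n x"
  by (simp add: enorm_L2)

lemma enorm_add: "enorm n (\<lambda>i. x i + y i) \<le> enorm n x + enorm n y"
  unfolding enorm_L2 by (rule L2_set_triangle_ineq)

lemma enorm_scale: "enorm n (\<lambda>i. a * x i) = \<bar>a\<bar> * enorm n x"
  by (simp add: enorm_def ip_def power2_eq_square[symmetric] power_mult_distrib
      sum_distrib_left[symmetric] real_sqrt_mult)

lemma enorm_minus: "enorm n (\<lambda>i. - x i) = enorm n x"
  using enorm_scale[of n "-1" x] by simp

lemma enorm_diff: "enorm n (\<lambda>i. x i - y i) \<le> enorm n x + enorm n y"
  using enorm_add[of n x "\<lambda>i. - y i"] by (simp add: enorm_minus)

lemma enorm_diff_ge: "enorm n x - enorm n y \<le> enorm n (\<lambda>i. x i - y i)"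
  using enorm_add[of n "\<lambda>i. x i - y i" y] by simp

lemma enorm_cong: "(\<And>i. i < n \<Longrightarrow> x i = y i) \<Longrightarrow> enorm n x = enorm n y"
  by (simp add: enorm_def ip_def)

lemma ip_cong: "(\<And>i. i < n \<Longrightarrow> x i = x' i) \<Longrightarrow> (\<And>i. i < n \<Longrightarrow> y i = y' i) \<Longrightarrow> ip n x y = ip n x' y'"
  by (simp add: ip_def)

lemma ip_commute: "ip n x y = ip n y x"
  by (simp add: ip_def mult.commute)

lemma ip_add: "ip n z (\<lambda>i. x i + y i) = ip n z x + ip n z y"
  by (simp add: ip_def sum.distrib distrib_left)

lemma ip_diff: "ip n z (\<lambda>i. x i - y i) = ip n z x - ip n z y"
  by (simp add: ip_def sum_subtractf right_diff_distrib)

lemma ip_scale: "ip n z (\<lambda>i. a * x i) = a * ip n z x"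
  by (simp add: ip_def sum_distrib_left mult_ac)

lemma component_le_enorm: "i < n \<Longrightarrow> \<bar>x i\<bar> \<le> enorm n x"
  using member_le_L2_set[of "{..<n}" i "\<lambda>i. \<bar>x i\<bar>"] by (simp add: enorm_L2 L2_set_def)

lemma ip_measurable [measurable]:
  assumes "sets \<mu> = sets (Rn_borel n)"
  shows "(\<lambda>x. ip n x y) \<in> borel_measurable \<mu>"
proof -
  have "(\<lambda>x. ip n x y) \<in> borel_measurable (Rn_borel n)"
    unfolding ip_def Rn_borel_def by measurable
  then show ?thesis using assms by (simp cong: measurable_cong_sets)
qed

lemma space_Rn:
  assumes "sets \<mu> = sets (Rn_borel n)"
  shows "space \<mu> = Rn n"
  using sets_eq_imp_space_eq[OF assms] by (simp add: Rn_borel_def Rn_def space_PiM)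

section \<open>Tail bounds for independent samples\<close>

text \<open>Markov's inequality for the product: by independence its expectation factors into
  \<open>N\<close> integrals, each at most 2.\<close>

lemma product_tail:
  fixes g :: "'a \<Rightarrow> ennreal"
  assumes "prob_space \<mu>" and g[measurable]: "g \<in> borel_measurable \<mu>"
    and g2: "(\<integral>\<^sup>+x. g x \<partial>\<mu>) \<le> 2" and B: "B > 0"
  shows "emeasure (PiM {..<N} (\<lambda>_. \<mu>)) {X \<in> space (PiM {..<N} (\<lambda>_. \<mu>)). ennreal B \<le> (\<Prod>i<N. g (X i))}
     \<le> ennreal (2 ^ N / B)"
proof -
  interpret prob_space \<mu> by fact
  interpret P: product_sigma_finite "\<lambda>_::nat. \<mu>" by unfold_locales
  let ?M = "PiM {..<N} (\<lambda>_. \<mu>)"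
  have m: "(\<lambda>X. \<Prod>i<N. g (X i)) \<in> borel_measurable ?M" by measurable
  have "ennreal B * emeasure ?M {X \<in> space ?M. ennreal B \<le> (\<Prod>i<N. g (X i))}
     = (\<integral>\<^sup>+X. ennreal B * indicator {X \<in> space ?M. ennreal B \<le> (\<Prod>i<N. g (X i))} X \<partial>?M)"
    using m by (simp add: nn_integral_cmult_indicator)
  also have "\<dots> \<le> (\<integral>\<^sup>+X. (\<Prod>i<N. g (X i)) \<partial>?M)"
    by (intro nn_integral_mono) (auto split: split_indicator)
  also have "\<dots> = (\<Prod>i<N. (\<integral>\<^sup>+x. g x \<partial>\<mu>))"
    by (rule P.product_nn_integral_prod) auto
  also have "\<dots> \<le> (\<Prod>i<N. 2)" by (induction N) (auto intro!: mult_mono g2)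
  also have "\<dots> = ennreal (2 ^ N)" by (simp add: ennreal_power[symmetric])
  also have "\<dots> = ennreal B * ennreal (2 ^ N / B)"
    using B by (simp add: ennreal_mult[symmetric])
  finally have *: "ennreal B * emeasure ?M {X \<in> space ?M. ennreal B \<le> (\<Prod>i<N. g (X i))}
     \<le> ennreal B * ennreal (2 ^ N / B)" .
  show ?thesis
    using * B by (subst (asm) ennreal_mult_le_mult_iff) auto
qed

text \<open>Samples in \<open>E\<close> get the weight \<open>1 + 1/q\<close> and all others the
  weight 1. The mean weight is then at most 2, and \<open>m\<close> hits push the product of the
  weights above \<open>(1/q) ^ m\<close>.\<close>

lemma count_tail:
  assumes "prob_space \<mu>" and E[measurable]: "E \<in> sets \<mu>" and Eq: "measure \<mu> E \<le> q" and q: "q > 0"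
  shows "emeasure (PiM {..<N} (\<lambda>_. \<mu>)) {X \<in> space (PiM {..<N} (\<lambda>_. \<mu>)). m \<le> card {i. i < N \<and> X i \<in> E}}
     \<le> ennreal (2 ^ N * q ^ m)"
proof -
  interpret prob_space \<mu> by fact
  let ?M = "PiM {..<N} (\<lambda>_. \<mu>)"
  \<comment> \<open>on the event in question the product of the \<open>h (X i)\<close> is at least \<open>(1/q) ^ m\<close>\<close>
  define h where "h = (\<lambda>x. 1 + indicator E x / q :: real)"
  have h1: "h x \<ge> 1" for x using q by (simp add: h_def)
  have [measurable]: "h \<in> borel_measurable \<mu>" unfolding h_def by measurable
  have int: "(\<integral>\<^sup>+x. ennreal (h x) \<partial>\<mu>) \<le> 2"
  proof -
    have "(\<integral>\<^sup>+x. ennreal (h x) \<partial>\<mu>) = (\<integral>\<^sup>+x. 1 + ennreal (1/q) * indicator E x \<partial>\<mu>)"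
      unfolding h_def using q
      by (intro nn_integral_cong) (auto split: split_indicator simp: ennreal_plus)
    also have "\<dots> = 1 + ennreal (1/q) * emeasure \<mu> E"
      by (subst nn_integral_add) (auto simp: nn_integral_cmult_indicator emeasure_space_1)
    also have "\<dots> = ennreal (1 + measure \<mu> E / q)"
      using q by (simp add: emeasure_eq_measure ennreal_mult[symmetric] ennreal_plus)
    also have "\<dots> \<le> ennreal 2" using Eq q by (intro ennreal_leI) (simp add: field_simps)
    finally show ?thesis by simp
  qed
  have sub: "{X \<in> space ?M. m \<le> card {i. i < N \<and> X i \<in> E}}
      \<subseteq> {X \<in> space ?M. ennreal ((1/q)^m) \<le> (\<Prod>i<N. ennreal (h (X i)))}"
  proof safe
    fix X assume "X \<in> space ?M" and m: "m \<le> card {i. i < N \<and> X i \<in> E}"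
    then obtain F where F: "F \<subseteq> {i. i < N \<and> X i \<in> E}" "card F = m"
      by (metis obtain_subset_with_card_n)
    have finF: "finite F" using F(1) by (rule finite_subset) auto
    have "(1/q)^m = (\<Prod>i\<in>F. 1/q)" using F by simp
    also have "\<dots> \<le> (\<Prod>i\<in>F. h (X i))"
      using F q by (intro prod_mono) (auto simp: h_def)
    also have "\<dots> \<le> (\<Prod>i<N. h (X i))"
      using F h1 by (intro prod_mono2) (auto intro: order_trans[OF zero_le_one])
    finally show "ennreal ((1/q)^m) \<le> (\<Prod>i<N. ennreal (h (X i)))"
      using h1 by (subst prod_ennreal) (auto intro: order_trans[OF zero_le_one] ennreal_leI)
  qed
  have "emeasure ?M {X \<in> space ?M. m \<le> card {i. i < N \<and> X i \<in> E}} 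
     \<le> emeasure ?M {X \<in> space ?M. ennreal ((1/q)^m) \<le> (\<Prod>i<N. ennreal (h (X i)))}"
    by (rule emeasure_mono[OF sub]) measurable
  also have "\<dots> \<le> ennreal (2 ^ N / (1/q)^m)"
    using q by (intro product_tail[OF assms(1) _ int]) auto
  finally show ?thesis by (simp add: power_one_over)
qed

section \<open>Admissible constants for the psi-2 norm\<close>

text \<open>Working with single admissible constants avoids the question whether the infimum in
  \<open>psi2\<close> is attained.\<close>

definition psi2_adm :: "'a measure \<Rightarrow> ('a \<Rightarrow> real) \<Rightarrow> real \<Rightarrow> bool" where
  "psi2_adm M f C \<longleftrightarrow> C > 0 \<and> (\<integral>\<^sup>+x. ennreal (exp ((f x)\<^sup>2 / C\<^sup>2)) \<partial>M) \<le> 2"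

text \<open>Exponentiating turns the sum of squares into a product whose factors have mean at most 2
  by admissibility, so \<open>product_tail\<close> applies with \<open>B = exp L\<close>.\<close>

lemma psi2_tail:
  assumes "prob_space \<mu>" and f[measurable]: "f \<in> borel_measurable \<mu>" and C: "psi2_adm \<mu> f C"
  shows "emeasure (PiM {..<N} (\<lambda>_. \<mu>)) {X \<in> space (PiM {..<N} (\<lambda>_. \<mu>)). C\<^sup>2 * L \<le> (\<Sum>i<N. (f (X i))\<^sup>2)}
     \<le> ennreal (2 ^ N * exp (- L))"
proof -
  let ?M = "PiM {..<N} (\<lambda>_. \<mu>)"
  have "C > 0" using C by (simp add: psi2_adm_def)
  have eq: "(\<Prod>i<N. ennreal (exp ((f (X i))\<^sup>2 / C\<^sup>2))) = ennreal (exp ((\<Sum>i<N. (f (X i))\<^sup>2) / C\<^sup>2))" for X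
    by (subst prod_ennreal) (auto simp: exp_sum[symmetric] sum_divide_distrib)
  have "{X \<in> space ?M. C\<^sup>2 * L \<le> (\<Sum>i<N. (f (X i))\<^sup>2)}
      = {X \<in> space ?M. ennreal (exp L) \<le> (\<Prod>i<N. ennreal (exp ((f (X i))\<^sup>2 / C\<^sup>2)))}"
    unfolding eq using \<open>C > 0\<close> by (auto simp: ennreal_le_iff field_simps)
  also have "emeasure ?M \<dots> \<le> ennreal (2 ^ N / exp L)"
    using C by (intro product_tail[OF assms(1)]) (auto simp: psi2_adm_def)
  finally show ?thesis by (simp add: exp_minus divide_inverse)
qed

lemma psi2_adm_mono:
  assumes "psi2_adm M f C" "C \<le> D"
  shows "psi2_adm M f D"
proof -
  have "C > 0" using assms(1) by (simp add: psi2_adm_def)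
  have "(\<integral>\<^sup>+x. ennreal (exp ((f x)\<^sup>2 / D\<^sup>2)) \<partial>M) \<le> (\<integral>\<^sup>+x. ennreal (exp ((f x)\<^sup>2 / C\<^sup>2)) \<partial>M)"
    using \<open>C > 0\<close> assms(2)
    by (intro nn_integral_mono ennreal_leI) (auto intro!: divide_left_mono power_mono)
  then show ?thesis using assms by (auto simp: psi2_adm_def intro: order_trans)
qed

lemma psi2_less_imp_adm:
  assumes "psi2 M f < ennreal C"
  shows "psi2_adm M f C"
proof -
  obtain D where "psi2_adm M f D" "ennreal D < ennreal C"
    using assms unfolding psi2_def Inf_less_iff psi2_adm_def by blast
  moreover from this have "D \<le> C" using ennreal_less_iff[of D C]
    by (simp add: psi2_adm_def)
  ultimately show ?thesis using psi2_adm_mono by blast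
qed

lemma psi2_le: "psi2_adm M f C \<Longrightarrow> psi2 M f \<le> ennreal C"
  unfolding psi2_def psi2_adm_def by (rule Inf_lower) auto

text \<open>Integrate \<open>1 + u <= exp u\<close> with
  \<open>u = (f x)\<^sup>2 / C\<^sup>2\<close>. For isotropic measures this compares the Euclidean
  metric with the psi-2 metric.\<close>

lemma second_moment_le_psi2_adm:
  assumes "prob_space M" and f[measurable]: "f \<in> borel_measurable M" and C: "psi2_adm M f C"
  shows "(\<integral>\<^sup>+x. ennreal ((f x)\<^sup>2) \<partial>M) \<le> ennreal (C\<^sup>2)"
proof -
  interpret prob_space M by fact
  have C0: "C > 0" using C by (simp add: psi2_adm_def)
  let ?J = "\<integral>\<^sup>+x. ennreal ((f x)\<^sup>2 / C\<^sup>2) \<partial>M"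
  have "1 + ?J = (\<integral>\<^sup>+x. 1 + ennreal ((f x)\<^sup>2 / C\<^sup>2) \<partial>M)"
    by (subst nn_integral_add) (auto simp: emeasure_space_1)
  also have "\<dots> \<le> (\<integral>\<^sup>+x. ennreal (exp ((f x)\<^sup>2 / C\<^sup>2)) \<partial>M)"
  proof (intro nn_integral_mono)
    fix x
    have "1 + ennreal ((f x)\<^sup>2 / C\<^sup>2) = ennreal (1 + (f x)\<^sup>2 / C\<^sup>2)"
      by (simp add: ennreal_plus)
    also have "\<dots> \<le> ennreal (exp ((f x)\<^sup>2 / C\<^sup>2))"
      by (intro ennreal_leI) (metis exp_ge_add_one_self)
    finally show "1 + ennreal ((f x)\<^sup>2 / C\<^sup>2) \<le> ennreal (exp ((f x)\<^sup>2 / C\<^sup>2))" .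
  qed
  also have "\<dots> \<le> 1 + 1" using C by (simp add: psi2_adm_def)
  finally have J: "?J \<le> 1" by (subst (asm) ennreal_add_left_cancel_le) simp
  have "(\<integral>\<^sup>+x. ennreal ((f x)\<^sup>2) \<partial>M) = (\<integral>\<^sup>+x. ennreal (C\<^sup>2) * ennreal ((f x)\<^sup>2 / C\<^sup>2) \<partial>M)"
    using C0 by (intro nn_integral_cong) (simp add: ennreal_mult[symmetric])
  also have "\<dots> = ennreal (C\<^sup>2) * ?J" by (rule nn_integral_cmult) measurable
  also have "\<dots> \<le> ennreal (C\<^sup>2) * 1" using J by (intro mult_left_mono) auto
  finally show ?thesis by simp
qed

text \<open>The triangle inequality for a common constant:
  \<open>(a - b)\<^sup>2 <= 2 * a\<^sup>2 + 2 * b\<^sup>2\<close> splits the exponential into a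
  product, which the arithmetic-geometric mean inequality turns into an average of the two given
  exponentials.\<close>

lemma psi2_adm_diff:
  assumes [measurable]: "f \<in> borel_measurable M" "g \<in> borel_measurable M"
    and f: "psi2_adm M f C" and g: "psi2_adm M g C"
  shows "psi2_adm M (\<lambda>x. f x - g x) (2 * C)"
proof -
  have C0: "C > 0" using f by (simp add: psi2_adm_def)
  have conv: "exp ((a - b)\<^sup>2 / (2 * C)\<^sup>2) \<le> (exp (a\<^sup>2 / C\<^sup>2) + exp (b\<^sup>2 / C\<^sup>2)) / 2" for a b :: real
  proof -
    have "(a - b)\<^sup>2 \<le> 2 * a\<^sup>2 + 2 * b\<^sup>2"
      using zero_le_power2[of "a + b"] by (simp add: power2_eq_square algebra_simps)
    then have "(a - b)\<^sup>2 / (4 * C\<^sup>2) \<le> (2 * a\<^sup>2 + 2 * b\<^sup>2) / (4 * C\<^sup>2)"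
      using C0 by (intro divide_right_mono) auto
    also have "\<dots> = a\<^sup>2 / C\<^sup>2 / 2 + b\<^sup>2 / C\<^sup>2 / 2"
      using C0 by (simp add: field_simps)
    finally have "(a - b)\<^sup>2 / (2 * C)\<^sup>2 \<le> a\<^sup>2 / C\<^sup>2 / 2 + b\<^sup>2 / C\<^sup>2 / 2"
      by (simp add: power_mult_distrib)
    then have "exp ((a - b)\<^sup>2 / (2 * C)\<^sup>2) \<le> exp (a\<^sup>2 / C\<^sup>2 / 2) * exp (b\<^sup>2 / C\<^sup>2 / 2)"
      by (simp add: exp_add[symmetric])
    also have "\<dots> \<le> ((exp (a\<^sup>2 / C\<^sup>2 / 2))\<^sup>2 + (exp (b\<^sup>2 / C\<^sup>2 / 2))\<^sup>2) / 2"
      using sum_squares_bound[of "exp (a\<^sup>2 / C\<^sup>2 / 2)" "exp (b\<^sup>2 / C\<^sup>2 / 2)"] by simp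
    finally show ?thesis by (simp add: exp_double[symmetric])
  qed
  have "(\<integral>\<^sup>+x. ennreal (exp ((f x - g x)\<^sup>2 / (2 * C)\<^sup>2)) \<partial>M)
      \<le> (\<integral>\<^sup>+x. (ennreal (exp ((f x)\<^sup>2 / C\<^sup>2)) + ennreal (exp ((g x)\<^sup>2 / C\<^sup>2))) / 2 \<partial>M)"
  proof (intro nn_integral_mono)
    fix x
    have "ennreal (exp ((f x - g x)\<^sup>2 / (2 * C)\<^sup>2)) \<le> ennreal ((exp ((f x)\<^sup>2 / C\<^sup>2) + exp ((g x)\<^sup>2 / C\<^sup>2)) / 2)"
      by (intro ennreal_leI conv)
    then show "ennreal (exp ((f x - g x)\<^sup>2 / (2 * C)\<^sup>2)) \<le> (ennreal (exp ((f x)\<^sup>2 / C\<^sup>2)) + ennreal (exp ((g x)\<^sup>2 / C\<^sup>2))) / 2"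
      by (simp add: ennreal_plus[symmetric] divide_ennreal[symmetric] ennreal_numeral[symmetric] add_nonneg_nonneg del: ennreal_plus ennreal_numeral)
  qed
  also have "\<dots> = ((\<integral>\<^sup>+x. ennreal (exp ((f x)\<^sup>2 / C\<^sup>2)) \<partial>M) + (\<integral>\<^sup>+x. ennreal (exp ((g x)\<^sup>2 / C\<^sup>2)) \<partial>M)) / 2"
    by (subst nn_integral_divide) (auto simp: nn_integral_add)
  also have "\<dots> \<le> (2 + 2) / 2"
    using f g by (intro divide_right_mono_ennreal add_mono) (auto simp: psi2_adm_def)
  also have "\<dots> = (2::ennreal)"
  proof -
    have "(2 + 2) / 2 = ennreal (4 / 2)" 
      by (subst divide_ennreal[symmetric]) auto
    then show ?thesis by simp
  qed
  finally show ?thesis using C0 by (simp add: psi2_adm_def)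
qed

section \<open>Small ball estimate for log-concave marginals\<close>

lemma neg_vec_in_Rn: "neg_vec n x \<in> Rn n"
  by (simp add: neg_vec_def Rn_def)

lemma ip_neg_vec: "ip n (neg_vec n x) y = - ip n x y"
  unfolding ip_def neg_vec_def sum_negf[symmetric] by (rule sum.cong) auto

lemma neg_vec_neg_vec:
  assumes "x \<in> Rn n"
  shows "neg_vec n (neg_vec n x) = x"
proof
  fix i
  show "neg_vec n (neg_vec n x) i = x i"
    using assms by (cases "i < n") (auto simp: neg_vec_def Rn_def PiE_def extensional_def)
qed

locale iso_log_concave =
  fixes n :: nat and \<mu> :: "(nat \<Rightarrow> real) measure"
  assumes prob_mu: "prob_space \<mu>" and sets_mu: "sets \<mu> = sets (Rn_borel n)"
    and symm: "symmetric_meas n \<mu>" and iso: "isotropic n \<mu>" and lc: "log_concave n \<mu>"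
begin

sublocale prob_space \<mu> by (rule prob_mu)

lemma ip_meas [measurable]: "(\<lambda>x. ip n x y) \<in> borel_measurable \<mu>"
  using sets_mu by (rule ip_measurable)

lemma second_moment: "(\<integral>\<^sup>+x. ennreal ((ip n x y)\<^sup>2) \<partial>\<mu>) = ennreal ((enorm n y)\<^sup>2)"
proof (cases "enorm n y = 0")
  case True
  then have "y i = 0" if "i < n" for i
    using component_le_enorm[OF that, of y] by simp
  then have "ip n x y = 0" for x by (simp add: ip_def)
  then show ?thesis using True by simp
next
  case False
  have "restrict y {..<n} \<in> Rn n" by (simp add: Rn_def)
  then have "(\<integral>x. (ip n x (restrict y {..<n}))\<^sup>2 \<partial>\<mu>) = (enorm n (restrict y {..<n}))\<^sup>2"
    using iso unfolding isotropic_def by blast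
  moreover have "ip n x (restrict y {..<n}) = ip n x y" for x by (rule ip_cong) auto
  moreover have "enorm n (restrict y {..<n}) = enorm n y" by (rule enorm_cong) auto
  ultimately have eq: "(\<integral>x. (ip n x y)\<^sup>2 \<partial>\<mu>) = (enorm n y)\<^sup>2" by simp
  \<comment> \<open>A nonintegrable function has Bochner integral 0 by convention, so a nonzero
    value forces integrability. This is why the vanishing norm is a separate case.\<close>
  then have "integrable \<mu> (\<lambda>x. (ip n x y)\<^sup>2)"
    using False not_integrable_integral_eq by fastforce
  then show ?thesis using eq by (subst nn_integral_eq_integral) auto
qed

section \<open>One-dimensional marginals of the log-concave measure\<close>

definition slab :: "(nat \<Rightarrow> real) \<Rightarrow> real set \<Rightarrow> real" where
  "slab y I = measure \<mu> {x \<in> space \<mu>. ip n x y \<in> I}"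

lemma slab_sets: "I \<in> sets borel \<Longrightarrow> {x \<in> space \<mu>. ip n x y \<in> I} \<in> sets \<mu>"
  using measurable_sets[OF ip_meas, of I y] by (simp add: vimage_def Int_def conj_commute)

lemma slab_nonneg [simp]: "0 \<le> slab y I"
  by (simp add: slab_def)

lemma slab_mono: "I \<subseteq> J \<Longrightarrow> J \<in> sets borel \<Longrightarrow> slab y I \<le> slab y J"
  unfolding slab_def by (rule finite_measure_mono) (auto intro: slab_sets)

text \<open>Log-concavity passes to the marginals, because a combination of points of two slabs has
  the combined inner product with \<open>y\<close>. The preimage of \<open>L\<close> is a measurable
  superset of the Minkowski combination, so its measure bounds the outer measure.\<close>

lemma slab_concave:
  assumes t: "0 < t" "t < 1" and B: "I \<in> sets borel" "J \<in> sets borel" "L \<in> sets borel"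
    and sub: "\<And>a b. a \<in> I \<Longrightarrow> b \<in> J \<Longrightarrow> t * a + (1 - t) * b \<in> L"
  shows "slab y I powr t * slab y J powr (1 - t) \<le> slab y L"
proof -
  let ?S = "\<lambda>I. {x \<in> space \<mu>. ip n x y \<in> I}"
  have S: "I \<in> sets borel \<Longrightarrow> ?S I \<in> sets \<mu>" for I by (rule slab_sets)
  show ?thesis
  proof (cases "?S I = {} \<or> ?S J = {}")
    case True
    \<comment> \<open>\<open>log_concave\<close> speaks of nonempty sets only; an empty preimage has
      measure 0 and makes the left-hand side vanish.\<close>
    then have "slab y I = 0 \<or> slab y J = 0"
      unfolding slab_def by (elim disjE) (simp_all only: measure_empty, simp_all)
    then show ?thesis using slab_nonneg[of y L] by (elim disjE) simp_all
  next
    case False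
    have "msum n t (?S I) (?S J) \<subseteq> ?S L"
    proof
      fix z assume "z \<in> msum n t (?S I) (?S J)"
      then obtain a b where z: "z = restrict (\<lambda>i. t * a i + (1 - t) * b i) {..<n}"
        and a: "a \<in> ?S I" and b: "b \<in> ?S J" unfolding msum_def by blast
      have "ip n z y = t * ip n a y + (1 - t) * ip n b y"
        by (simp add: z ip_def sum_distrib_left sum.distrib[symmetric] distrib_right mult.assoc)
      moreover have "z \<in> space \<mu>" by (simp add: z space_Rn[OF sets_mu] Rn_def)
      moreover have "t * ip n a y + (1 - t) * ip n b y \<in> L" using a b by (intro sub) auto
      ultimately show "z \<in> ?S L" by (simp only: mem_Collect_eq)
    qed
    then have "outer_meas \<mu> (msum n t (?S I) (?S J)) \<le> measure \<mu> (?S L)"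
      unfolding outer_meas_def using S[OF B(3)]
      by (intro cInf_lower) (auto intro!: bdd_belowI[of _ 0])
    moreover have "measure \<mu> (?S I) powr t * measure \<mu> (?S J) powr (1 - t)
        \<le> outer_meas \<mu> (msum n t (?S I) (?S J))"
      using lc[unfolded log_concave_def, rule_format, of t "?S I" "?S J"] t S[OF B(1)] S[OF B(2)] False
      by blast
    ultimately show ?thesis by (simp add: slab_def)
  qed
qed

lemma slab_neg:
  assumes "I \<in> sets borel"
  shows "slab y {a. - a \<in> I} = slab y I"
proof -
  let ?S = "{x \<in> space \<mu>. ip n x y \<in> I}"
  have "neg_vec n ` ?S = {x \<in> space \<mu>. - ip n x y \<in> I}"
  proof (intro equalityI subsetI)
    fix x assume "x \<in> neg_vec n ` ?S"
    then obtain z where "x = neg_vec n z" "z \<in> ?S" by (rule imageE)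
    then show "x \<in> {x \<in> space \<mu>. - ip n x y \<in> I}"
      by (simp add: ip_neg_vec space_Rn[OF sets_mu] neg_vec_in_Rn)
  next
    fix x assume x: "x \<in> {x \<in> space \<mu>. - ip n x y \<in> I}"
    then have "x = neg_vec n (neg_vec n x)"
      using neg_vec_neg_vec space_Rn[OF sets_mu] by simp
    moreover have "neg_vec n x \<in> ?S"
      using x by (simp add: ip_neg_vec space_Rn[OF sets_mu] neg_vec_in_Rn)
    ultimately show "x \<in> neg_vec n ` ?S" by (rule image_eqI)
  qed
  moreover have "?S \<in> sets \<mu>" using assms by (rule slab_sets)
  ultimately show ?thesis using symm unfolding symmetric_meas_def slab_def by auto
qed

text \<open>With weight \<open>1/m\<close> on the \<open>m\<close>-th shifted interval and
  \<open>1 - 1/m\<close> on the central one, every average lands in \<open>{e<..3*e}\<close>. Taking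
  the \<open>m\<close>-th power of \<open>slab_concave\<close> clears the fractional
  exponents.\<close>

lemma slab_shifted_le:
  assumes e: "e > 0" and m: "m \<ge> (1::nat)" and q0: "slab y {-e..e} > 0"
  shows "slab y {(2 * real m - 1) * e<..(2 * real m + 1) * e} * slab y {-e..e} ^ (m - 1) \<le> slab y {e<..3*e} ^ m"
proof (cases "m = 1 \<or> slab y {(2 * real m - 1) * e<..(2 * real m + 1) * e} = 0")
  case True
  \<comment> \<open>\<open>slab_concave\<close> requires a weight strictly below 1, which excludes
    \<open>m = 1\<close>; there both sides coincide.\<close>
  then show ?thesis by (auto simp: zero_le_power)
next
  case False
  define qm where "qm = slab y {(2 * real m - 1) * e<..(2 * real m + 1) * e}"
  define q0 where "q0 = slab y {-e..e}"
  have qm: "qm > 0" using False slab_nonneg unfolding qm_def by (metis less_eq_real_def)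
  have q00: "q0 > 0" using assms by (simp add: q0_def)
  have m2: "m \<ge> 2" using False m by auto
  have "qm powr (1 / m) * q0 powr (1 - 1 / m) \<le> slab y {e<..3*e}"
    unfolding qm_def q0_def
  proof (rule slab_concave)
    fix a b assume a: "a \<in> {(2 * real m - 1) * e<..(2 * real m + 1) * e}" and b: "b \<in> {-e..e}"
    have "m * e < a + (m - 1) * b"
    proof -
      have "(real m - 1) * (-e) \<le> (real m - 1) * b" using b m by (intro mult_left_mono) auto
      then show ?thesis using a m by (simp add: algebra_simps of_nat_diff)
    qed
    moreover have "a + (m - 1) * b \<le> 3 * m * e"
    proof -
      have "(real m - 1) * b \<le> (real m - 1) * e" using b m by (intro mult_left_mono) auto
      then show ?thesis using a m by (simp add: algebra_simps of_nat_diff)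
    qed
    moreover have "1 / m * a + (1 - 1 / m) * b = (a + (m - 1) * b) / m"
      using m by (simp add: field_simps of_nat_diff)
    ultimately show "1 / m * a + (1 - 1 / m) * b \<in> {e<..3 * e}"
      using m by (simp add: field_simps)
  qed (use m2 in auto)
  then have "(qm powr (1 / m) * q0 powr (1 - 1 / m)) ^ m \<le> slab y {e<..3*e} ^ m"
    by (intro power_mono) auto
  also have "(qm powr (1 / m) * q0 powr (1 - 1 / m)) ^ m = qm * q0 ^ (m - 1)"
  proof -
    have "(qm powr (1 / m)) ^ m = qm"
      using qm m by (subst powr_realpow[symmetric]) (auto simp: powr_powr)
    moreover have "(q0 powr (1 - 1 / m)) ^ m = q0 powr (real (m - 1))"
      using q00 m by (subst powr_realpow[symmetric]) (auto simp: powr_powr left_diff_distrib of_nat_diff)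
    ultimately show ?thesis using q00 by (simp add: power_mult_distrib powr_realpow)
  qed
  finally show ?thesis by (simp add: qm_def q0_def)
qed

text \<open>If the neighbouring slab were much lighter than the central one, log-concavity would force
  geometric decay of the marginal at scale \<open>e\<close>, contradicting its variance.\<close>
lemma slab_neighbour_ge:
  assumes e: "e > 0" and large: "3 * e < enorm n y"
  shows "slab y {-e..e} / 8 \<le> slab y {e<..3*e}"
proof (rule ccontr)
  assume light: "\<not> ?thesis"
  define q0 where "q0 = slab y {-e..e}"
  \<comment> \<open>\<open>J m\<close> is the shifted interval with index \<open>m + 1\<close>, so
    that \<open>J 0\<close> is the neighbour \<open>{e<..3*e}\<close> itself.\<close>
  define J where "J = (\<lambda>m::nat. {(2 * real (Suc m) - 1) * e<..(2 * real (Suc m) + 1) * e})"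
  have lt: "slab y {e<..3*e} < q0 / 8" using light by (simp add: q0_def)
  have q0: "q0 > 0" using lt slab_nonneg[of y "{e<..3*e}"] by linarith
  have q1: "q0 \<le> 1" by (simp add: q0_def slab_def)
  have dec: "slab y (J m) \<le> (1/8) ^ Suc m" for m
  proof -
    have "slab y (J m) * q0 ^ m \<le> slab y {e<..3*e} ^ Suc m"
      using slab_shifted_le[OF e, of "Suc m" y] q0 unfolding J_def q0_def by simp
    also have "\<dots> \<le> (q0 / 8) ^ Suc m" using lt by (intro power_mono) auto
    also have "\<dots> = (1/8) ^ Suc m * q0 * q0 ^ m" by (simp add: power_divide)
    also have "\<dots> \<le> (1/8) ^ Suc m * 1 * q0 ^ m"
      using q0 q1 by (intro mult_right_mono mult_left_mono) auto
    finally show ?thesis using q0 by simp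
  qed
  let ?Y = "\<lambda>x. ip n x y"
  have [measurable]: "J m \<in> sets borel" for m by (simp add: J_def)
  \<comment> \<open>The line is covered by the central interval, the intervals \<open>J m\<close>
    and their reflections; on each piece the square is bounded by that of the far endpoint.\<close>
  have pw: "ennreal (a\<^sup>2) \<le> ennreal (e\<^sup>2) + (\<Sum>m. ennreal (((2 * m + 3) * e)\<^sup>2) *
      (indicator (J m) a + indicator (J m) (- a)))" for a
  proof (cases "\<bar>a\<bar> \<le> e")
    case True
    then have "a\<^sup>2 \<le> e\<^sup>2" using e abs_le_square_iff[of a e] by simp
    then show ?thesis by (intro add_increasing2 ennreal_leI) auto
  next
    case False
    \<comment> \<open>The ceiling selects the half-open interval containing the absolute value of
      \<open>a\<close>: its left end is excluded and its right end included.\<close>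
    define k where "k = \<lceil>(\<bar>a\<bar> / e - 1) / 2\<rceil>"
    have "k > 0" using False e by (simp add: k_def field_simps)
    define m where "m = nat k - 1"
    have km: "of_int k = real (Suc m)" using \<open>k > 0\<close> by (simp add: m_def of_nat_nat)
    have "of_int k - 1 < (\<bar>a\<bar> / e - 1) / 2" "(\<bar>a\<bar> / e - 1) / 2 \<le> of_int k"
      unfolding k_def by linarith+
    then have *: "\<bar>a\<bar> \<in> J m" unfolding J_def km using e by (simp add: field_simps)
    then have "\<bar>a\<bar> \<le> (2 * m + 3) * e" by (simp add: J_def algebra_simps)
    then have "a\<^sup>2 \<le> ((2 * m + 3) * e)\<^sup>2" by (simp add: abs_le_square_iff[symmetric])
    then have "ennreal (a\<^sup>2) \<le> ennreal (((2 * m + 3) * e)\<^sup>2) * 1"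
      by (simp add: ennreal_leI)
    also have "\<dots> \<le> ennreal (((2 * m + 3) * e)\<^sup>2) * (indicator (J m) a + indicator (J m) (- a))"
    proof (intro mult_left_mono)
      show "1 \<le> indicator (J m) a + (indicator (J m) (- a) :: ennreal)"
        using * by (cases "a \<ge> 0") auto
    qed simp
    also have "\<dots> \<le> (\<Sum>m. ennreal (((2 * m + 3) * e)\<^sup>2) * (indicator (J m) a + indicator (J m) (- a)))"
      using sum_le_suminf[of "\<lambda>m. ennreal (((2 * m + 3) * e)\<^sup>2) * (indicator (J m) a + indicator (J m) (- a))" "{m}"]
      by simp
    finally show ?thesis by (intro add_increasing) auto
  qed
  have sl: "(\<integral>\<^sup>+x. indicator I (?Y x) \<partial>\<mu>) = ennreal (slab y I)" if [measurable]: "I \<in> sets borel" for I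
  proof -
    have "(\<integral>\<^sup>+x. indicator I (?Y x) \<partial>\<mu>) = (\<integral>\<^sup>+x. indicator {x \<in> space \<mu>. ?Y x \<in> I} x \<partial>\<mu>)"
      by (intro nn_integral_cong) (auto split: split_indicator)
    then show ?thesis by (simp add: slab_def emeasure_eq_measure)
  qed
  have sl': "(\<integral>\<^sup>+x. indicator I (- ?Y x) \<partial>\<mu>) = ennreal (slab y I)" if I[measurable]: "I \<in> sets borel" for I
  proof -
    have "{a. - a \<in> I} = uminus -` I \<inter> space borel" by auto
    also have "\<dots> \<in> sets borel" by measurable
    finally have "{a. - a \<in> I} \<in> sets borel" .
    moreover have "(\<integral>\<^sup>+x. indicator I (- ?Y x) \<partial>\<mu>) = (\<integral>\<^sup>+x. indicator {a. - a \<in> I} (?Y x) \<partial>\<mu>)"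
      by (intro nn_integral_cong) (auto split: split_indicator)
    ultimately show ?thesis using sl slab_neg[OF I] by simp
  qed
  have "ennreal ((enorm n y)\<^sup>2) = (\<integral>\<^sup>+x. ennreal ((?Y x)\<^sup>2) \<partial>\<mu>)" by (simp add: second_moment)
  also have "\<dots> \<le> (\<integral>\<^sup>+x. ennreal (e\<^sup>2) + (\<Sum>m. ennreal (((2 * m + 3) * e)\<^sup>2) *
      (indicator (J m) (?Y x) + indicator (J m) (- ?Y x))) \<partial>\<mu>)"
    by (intro nn_integral_mono pw)
  also have "\<dots> = ennreal (e\<^sup>2) + (\<Sum>m. ennreal (((2 * m + 3) * e)\<^sup>2) * (ennreal (slab y (J m)) + ennreal (slab y (J m))))"
    by (simp add: nn_integral_add nn_integral_suminf nn_integral_cmult sl sl' emeasure_space_1)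
  also have "\<dots> \<le> ennreal (e\<^sup>2) + (\<Sum>m. ennreal (e\<^sup>2 * (9 / 4) * (1/2) ^ m))"
  proof (intro add_left_mono suminf_le)
    fix m :: nat
    \<comment> \<open>This crude bound makes the squared endpoints grow at most like
      \<open>4 ^ m\<close>, while the masses decay like \<open>(1/8) ^ m\<close>, so a geometric
      series of ratio 1/2 remains.\<close>
    have "2 * real m + 3 \<le> 3 * 2 ^ m" by (induction m) auto
    then have "(2 * real m + 3)\<^sup>2 \<le> (3 * 2 ^ m)\<^sup>2" by (intro power_mono) auto
    also have "\<dots> = 9 * (2 * 2) ^ m" by (simp only: power_mult_distrib) (simp add: power2_eq_square)
    also have "\<dots> = 9 * 4 ^ m" by simp
    finally have *: "(2 * real m + 3)\<^sup>2 \<le> 9 * 4 ^ m" .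
    have "((2 * real m + 3) * e)\<^sup>2 * (slab y (J m) + slab y (J m)) \<le> (9 * 4 ^ m * e\<^sup>2) * (2 * (1/8) ^ Suc m)"
      unfolding power_mult_distrib using * dec[of m]
      by (intro mult_mono mult_right_mono) auto
    also have "\<dots> = e\<^sup>2 * (9 / 4) * (4 ^ m * (1/8) ^ m)" by simp
    also have "4 ^ m * (1/8) ^ m = (1/2 :: real) ^ m" unfolding power_mult_distrib[symmetric] by simp
    finally have **: "((2 * real m + 3) * e)\<^sup>2 * (slab y (J m) + slab y (J m)) \<le> e\<^sup>2 * (9 / 4) * (1/2) ^ m" .
    have "ennreal (((2 * m + 3) * e)\<^sup>2) * (ennreal (slab y (J m)) + ennreal (slab y (J m)))
       = ennreal (((2 * real m + 3) * e)\<^sup>2 * (slab y (J m) + slab y (J m)))"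
      by (subst ennreal_plus[symmetric]) (auto simp: ennreal_mult)
    then show "ennreal (((2 * m + 3) * e)\<^sup>2) * (ennreal (slab y (J m)) + ennreal (slab y (J m)))
       \<le> ennreal (e\<^sup>2 * (9 / 4) * (1/2) ^ m)"
      using ennreal_leI[OF **] by simp
  qed auto
  also have "(\<Sum>m. ennreal (e\<^sup>2 * (9 / 4) * (1/2) ^ m)) = ennreal (e\<^sup>2 * (9 / 4) * 2)"
  proof -
    have "(\<lambda>m. e\<^sup>2 * (9 / 4) * (1/2) ^ m) sums (e\<^sup>2 * (9 / 4) * 2)"
      using sums_mult[OF geometric_sums[of "1/2 :: real"], of "e\<^sup>2 * (9/4)"] by simp
    then show ?thesis by (intro suminf_ennreal_eq) auto
  qed
  \<comment> \<open>The variance would be at most \<open>5.5 * e\<^sup>2\<close>, whereas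
    \<open>large\<close> makes it exceed \<open>9 * e\<^sup>2\<close>.\<close>
  also have "ennreal (e\<^sup>2) + ennreal (e\<^sup>2 * (9 / 4) * 2) = ennreal (5.5 * e\<^sup>2)"
    by (subst ennreal_plus[symmetric]) auto
  finally have "(enorm n y)\<^sup>2 \<le> 5.5 * e\<^sup>2" by (simp add: ennreal_le_iff)
  moreover have "(3 * e)\<^sup>2 < (enorm n y)\<^sup>2" using large e by (intro power_strict_mono) auto
  moreover have "0 < e\<^sup>2" using e by simp
  ultimately show False unfolding power_mult_distrib by simp
qed

text \<open>The central interval and its two neighbours are disjoint, and by symmetry each neighbour
  carries at least 1/8 of the central mass. The union has at least 5/4 of that mass and lies within
  \<open>4*e\<close> of the origin.\<close>

lemma slab_doubling:
  assumes e: "e > 0" and large: "3 * e < enorm n y"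
  shows "slab y {-e..e} \<le> 4/5 * slab y {-(4*e)..4*e}"
proof -
  let ?S = "\<lambda>I. {x \<in> space \<mu>. ip n x y \<in> I}"
  let ?J = "{e<..3*e}" and ?I = "{-e..e}"
  have [measurable]: "{a. - a \<in> ?J} \<in> sets borel"
  proof -
    have "{a. - a \<in> ?J} = {-(3*e)..<-e}" by auto
    then show ?thesis by simp
  qed
  have "slab y ?I + slab y ?J + slab y {a. - a \<in> ?J} = measure \<mu> (?S ?I \<union> ?S ?J \<union> ?S {a. - a \<in> ?J})"
    unfolding slab_def
    by (subst finite_measure_Union; (subst finite_measure_Union)?) (use e in \<open>auto\<close>)
  also have "?S ?I \<union> ?S ?J \<union> ?S {a. - a \<in> ?J} = ?S (?I \<union> ?J \<union> {a. - a \<in> ?J})" by auto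
  also have "measure \<mu> \<dots> \<le> slab y {-(4*e)..4*e}"
    unfolding slab_def[symmetric] using e by (intro slab_mono) auto
  finally show ?thesis using slab_neighbour_ge[OF assms] slab_neg[of ?J y] by simp
qed

text \<open>Iterates \<open>slab_doubling\<close> downwards from the scale \<open>enorm n y\<close>,
  where the trivial bound 1 holds; each division by 4 gains a factor 4/5.\<close>

lemma small_ball:
  assumes "enorm n y > 0"
  shows "measure \<mu> {x \<in> space \<mu>. \<bar>ip n x y\<bar> \<le> enorm n y / 4 ^ k} \<le> (4/5) ^ k"
proof -
  have "slab y {-(enorm n y / 4 ^ k)..enorm n y / 4 ^ k} \<le> (4/5) ^ k"
  proof (induction k)
    case 0
    show ?case by (simp add: slab_def)
  next
    case (Suc k)
    have "3 < 4 * (4::real) ^ k" using one_le_power[of "4::real" k] by linarith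
    then have "slab y {-(enorm n y / 4 ^ Suc k)..enorm n y / 4 ^ Suc k}
       \<le> 4/5 * slab y {-(4 * (enorm n y / 4 ^ Suc k))..4 * (enorm n y / 4 ^ Suc k)}"
      using assms by (intro slab_doubling) (auto simp: field_simps)
    also have "\<dots> \<le> 4/5 * (4/5) ^ k" using Suc by simp
    finally show ?case by simp
  qed
  moreover have "{x \<in> space \<mu>. \<bar>ip n x y\<bar> \<le> enorm n y / 4 ^ k}
     = {x \<in> space \<mu>. ip n x y \<in> {-(enorm n y / 4 ^ k)..enorm n y / 4 ^ k}}"
    by (auto simp: abs_le_iff)
  ultimately show ?thesis by (simp add: slab_def)
qed

lemma chebyshev:
  assumes "a > 0"
  shows "measure \<mu> {x \<in> space \<mu>. a < \<bar>ip n x y\<bar>} \<le> (enorm n y / a)\<^sup>2"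
proof -
  let ?E = "{x \<in> space \<mu>. a < \<bar>ip n x y\<bar>}"
  have "ennreal (a\<^sup>2) * emeasure \<mu> ?E = (\<integral>\<^sup>+x. ennreal (a\<^sup>2) * indicator ?E x \<partial>\<mu>)"
    by (simp add: nn_integral_cmult_indicator)
  also have "\<dots> \<le> (\<integral>\<^sup>+x. ennreal ((ip n x y)\<^sup>2) \<partial>\<mu>)"
    using assms by (intro nn_integral_mono)
      (auto split: split_indicator intro!: ennreal_leI simp: abs_le_square_iff[symmetric])
  also have "\<dots> = ennreal ((enorm n y)\<^sup>2)" by (rule second_moment)
  finally have "a\<^sup>2 * measure \<mu> ?E \<le> (enorm n y)\<^sup>2"
    by (simp add: emeasure_eq_measure ennreal_mult[symmetric] ennreal_le_iff)
  then show ?thesis using assms by (simp add: power_divide field_simps)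
qed

end

section \<open>Chaining in the psi-2 metric\<close>

text \<open>Extracts real-valued data from the extended-real infimum: an admissible sequence with
  value below \<open>G\<close>, nearest-point maps \<open>\<pi>\<close> and their distances
  \<open>a\<close>. Partial sums replace the series so that all later estimates stay in the
  reals.\<close>

lemma gamma2_chain:
  assumes T: "T \<noteq> {}" and G: "gamma2 T d < ennreal G"
  obtains Ts \<pi> a where
    "\<And>s. Ts s \<subseteq> T" "\<And>s. finite (Ts s)" "\<And>s. card (Ts s) \<le> 2 ^ (2 ^ s)" "card (Ts 0) = 1"
    "\<And>s t. t \<in> T \<Longrightarrow> \<pi> s t \<in> Ts s"
    "\<And>s t. t \<in> T \<Longrightarrow> d t (\<pi> s t) = ennreal (a s t)" "\<And>s t. 0 \<le> a s t"
    "\<And>m t. t \<in> T \<Longrightarrow> (\<Sum>s<m. 2 powr (real s / 2) * a s t) \<le> G"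
proof -
  obtain Ts where Ts: "\<And>s. Ts s \<subseteq> T" "\<And>s. finite (Ts s)" "\<And>s. card (Ts s) \<le> 2 ^ (2 ^ s)" "card (Ts 0) = 1"
    and sup: "(SUP t\<in>T. (\<Sum>s. ennreal (2 powr (real s / 2)) * (INF u\<in>Ts s. d t u))) < ennreal G"
    using G T unfolding gamma2_def by (auto simp: Inf_less_iff)
  define \<pi> where "\<pi> = (\<lambda>s t. arg_min_on (d t) (Ts s))"
  define a where "a = (\<lambda>s t. enn2real (d t (\<pi> s t)))"
  have series: "(\<Sum>s. ennreal (2 powr (real s / 2)) * (INF u\<in>Ts s. d t u)) < ennreal G" if "t \<in> T" for t
    using that by (intro le_less_trans[OF _ sup] SUP_upper)
  have partial: "(\<Sum>s<m. ennreal (2 powr (real s / 2)) * (INF u\<in>Ts s. d t u)) < ennreal G" if "t \<in> T" for t m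
    by (rule le_less_trans[OF sum_le_suminf series[OF that]]) auto
  have single: "ennreal (2 powr (real s / 2)) * (INF u\<in>Ts s. d t u) < top" if "t \<in> T" for s t
  proof -
    have "ennreal (2 powr (real s / 2)) * (INF u\<in>Ts s. d t u)
        \<le> (\<Sum>s<Suc s. ennreal (2 powr (real s / 2)) * (INF u\<in>Ts s. d t u))"
      by (rule member_le_sum) auto
    also have "\<dots> < top" using partial[OF that, of "Suc s"] by (rule less_trans) simp
    finally show ?thesis .
  qed
  \<comment> \<open>The coefficient is positive, so an infinite distance would make a single term of
    the finite sum infinite.\<close>
  have inf: "(INF u\<in>Ts s. d t u) < top" if "t \<in> T" for s t
  proof (rule ccontr)
    assume "\<not> ?thesis"
    then have "(INF u\<in>Ts s. d t u) = top" unfolding less_top[symmetric] by (rule notnotD)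
    then show False using single[OF that, of s] by (simp add: ennreal_mult_top)
  qed
  \<comment> \<open>The infimum over the empty set is infinite, which \<open>inf\<close> rules
    out.\<close>
  have ne: "Ts s \<noteq> {}" for s
    using inf T by (metis INF_empty ex_in_conv less_irrefl)
  have pi: "\<pi> s t \<in> Ts s" for s t
    unfolding \<pi>_def using arg_min_if_finite(1)[OF Ts(2) ne] .
  have min: "d t (\<pi> s t) \<le> d t u" if "u \<in> Ts s" for s t u
    unfolding \<pi>_def using arg_min_least[OF Ts(2) ne that] .
  have eq: "(INF u\<in>Ts s. d t u) = d t (\<pi> s t)" for s t
    by (intro antisym INF_lower pi INF_greatest min)
  have da: "d t (\<pi> s t) = ennreal (a s t)" if "t \<in> T" for s t
    using inf[OF that, of s] unfolding eq a_def by (rule ennreal_enn2real[symmetric])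
  have a0: "0 \<le> a s t" for s t by (simp add: a_def)
  have "(\<Sum>s<m. 2 powr (real s / 2) * a s t) \<le> G" if "t \<in> T" for m t
  proof -
    have "ennreal (\<Sum>s<m. 2 powr (real s / 2) * a s t)
       = (\<Sum>s<m. ennreal (2 powr (real s / 2)) * (INF u\<in>Ts s. d t u))"
      by (subst sum_ennreal[symmetric]) (auto simp: eq da[OF that] ennreal_mult a0)
    also have "\<dots> < ennreal G" by (rule partial[OF that])
    finally show ?thesis
      by (subst (asm) ennreal_less_iff) (auto simp: a0 intro!: sum_nonneg)
  qed
  then show thesis using that[of Ts \<pi> a, OF Ts pi da a0] by blast
qed

context iso_log_concave
begin

lemma ip_meas' [measurable]: "(\<lambda>z. ip n y z) \<in> borel_measurable \<mu>"
  using ip_meas[of y] by (simp add: ip_commute[of n y])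

text \<open>By isotropy the Euclidean distance is the second-moment norm of the marginal, which
  every admissible psi-2 constant dominates.\<close>

lemma edist_le_psi2_dist: "ennreal (edist n u v) \<le> psi2_dist n \<mu> u v"
  unfolding psi2_dist_def psi2_def
proof (rule Inf_greatest)
  fix C' assume "C' \<in> {ennreal C |C. C > 0 \<and> (\<integral>\<^sup>+x. ennreal (exp ((ip n (\<lambda>i. u i - v i) x)\<^sup>2 / C\<^sup>2)) \<partial>\<mu>) \<le> 2}"
  then obtain C where C: "C' = ennreal C" "psi2_adm \<mu> (\<lambda>z. ip n (\<lambda>i. u i - v i) z) C"
    unfolding psi2_adm_def by blast
  have "ennreal ((edist n u v)\<^sup>2) = (\<integral>\<^sup>+x. ennreal ((ip n (\<lambda>i. u i - v i) x)\<^sup>2) \<partial>\<mu>)"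
    using second_moment[of "\<lambda>i. u i - v i"] by (simp add: edist_def ip_commute)
  also have "\<dots> \<le> ennreal (C\<^sup>2)"
    by (rule second_moment_le_psi2_adm[OF prob_mu _ C(2)]) measurable
  finally have "(edist n u v)\<^sup>2 \<le> C\<^sup>2" by (simp add: ennreal_le_iff)
  moreover have "C > 0" using C(2) by (simp add: psi2_adm_def)
  ultimately show "ennreal (edist n u v) \<le> C'"
    unfolding C(1) by (intro ennreal_leI) (rule power2_le_imp_le, auto)
qed

text \<open>Triangle inequality through \<open>p\<close>. Since \<open>psi2_adm_diff\<close> takes
  one constant for both functions, the sum of the two distances serves as that constant, at the cost
  of a factor 2; the slack \<open>e / 2\<close> makes it admissible.\<close>

lemma psi2_dist_link:
  assumes u: "psi2_dist n \<mu> p u = ennreal \<alpha>" and v: "psi2_dist n \<mu> p v = ennreal \<beta>"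
    and nn: "\<alpha> \<ge> 0" "\<beta> \<ge> 0"
  shows "psi2_dist n \<mu> u v \<le> ennreal (2 * (\<alpha> + \<beta>))"
proof (rule ennreal_le_epsilon)
  fix e :: real assume e: "e > 0"
  define C where "C = \<alpha> + \<beta> + e / 2"
  have "psi2_adm \<mu> (\<lambda>z. ip n (\<lambda>i. p i - v i) z) C" "psi2_adm \<mu> (\<lambda>z. ip n (\<lambda>i. p i - u i) z) C"
    using u v nn e unfolding psi2_dist_def C_def
    by (auto intro!: psi2_less_imp_adm simp: ennreal_less_iff simp del: ennreal_plus)
  then have "psi2_adm \<mu> (\<lambda>z. ip n (\<lambda>i. p i - v i) z - ip n (\<lambda>i. p i - u i) z) (2 * C)"
    by (intro psi2_adm_diff) auto
  moreover have "ip n (\<lambda>i. p i - v i) z - ip n (\<lambda>i. p i - u i) z = ip n (\<lambda>i. u i - v i) z" for z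
    by (simp add: ip_def sum_subtractf[symmetric] algebra_simps)
  ultimately have "psi2_dist n \<mu> u v \<le> ennreal (2 * C)"
    unfolding psi2_dist_def by (intro psi2_le) simp
  also have "2 * C = 2 * (\<alpha> + \<beta>) + e" by (simp add: C_def)
  also have "ennreal (2 * (\<alpha> + \<beta>) + e) = ennreal (2 * (\<alpha> + \<beta>)) + ennreal e"
    using nn e by (intro ennreal_plus) auto
  finally show "psi2_dist n \<mu> u v \<le> ennreal (2 * (\<alpha> + \<beta>)) + ennreal e" .
qed

end

section \<open>Failure probabilities and union bounds\<close>

text \<open>\<open>fails_le M q P\<close>: the event \<open>P\<close>, which need not be measurable, fails with probability at most \<open>q\<close>.\<close>
definition fails_le :: "'a measure \<Rightarrow> real \<Rightarrow> ('a \<Rightarrow> bool) \<Rightarrow> bool" where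
  "fails_le M q P \<longleftrightarrow> (\<exists>B\<in>sets M. emeasure M B \<le> ennreal q \<and> (\<forall>X\<in>space M - B. P X))"

lemma fails_leI:
  "B \<in> sets M \<Longrightarrow> emeasure M B \<le> ennreal q \<Longrightarrow> (\<And>X. X \<in> space M \<Longrightarrow> X \<notin> B \<Longrightarrow> P X) \<Longrightarrow> fails_le M q P"
  unfolding fails_le_def by blast

lemma fails_le_mono:
  assumes "fails_le M q P" "q \<le> q'" "\<And>X. X \<in> space M \<Longrightarrow> P X \<Longrightarrow> Q X"
  shows "fails_le M q' Q"
  using assms ennreal_leI[OF assms(2)] unfolding fails_le_def by (meson DiffD1 order_trans)

lemma fails_le_conj:
  assumes "fails_le M p P" "fails_le M q Q" "p \<ge> 0" "q \<ge> 0"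
  shows "fails_le M (p + q) (\<lambda>X. P X \<and> Q X)"
proof -
  obtain A B where A: "A \<in> sets M" "emeasure M A \<le> ennreal p" "\<forall>X\<in>space M - A. P X"
    and B: "B \<in> sets M" "emeasure M B \<le> ennreal q" "\<forall>X\<in>space M - B. Q X"
    using assms unfolding fails_le_def by blast
  have "emeasure M (A \<union> B) \<le> emeasure M A + emeasure M B" using A B by (intro emeasure_subadditive)
  also have "\<dots> \<le> ennreal (p + q)" using A B assms by (subst ennreal_plus) (auto intro: add_mono)
  finally show ?thesis using A B by (intro fails_leI[of "A \<union> B"]) auto
qed

lemma fails_le_finite:
  assumes I: "finite I" and P: "\<And>i. i \<in> I \<Longrightarrow> fails_le M q (P i)" and q: "q \<ge> 0"
    and c: "real (card I) * q \<le> q'"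
  shows "fails_le M q' (\<lambda>X. \<forall>i\<in>I. P i X)"
proof -
  obtain B where B: "\<And>i. i \<in> I \<Longrightarrow> B i \<in> sets M \<and> emeasure M (B i) \<le> ennreal q \<and> (\<forall>X\<in>space M - B i. P i X)"
    using P unfolding fails_le_def by metis
  have "emeasure M (\<Union>i\<in>I. B i) \<le> (\<Sum>i\<in>I. emeasure M (B i))"
    using I B by (intro emeasure_subadditive_finite) auto
  also have "\<dots> \<le> (\<Sum>i\<in>I. ennreal q)" using B by (intro sum_mono) auto
  also have "\<dots> = ennreal (real (card I) * q)" using q by (simp add: ennreal_mult ennreal_of_nat_eq_real_of_nat)
  also have "\<dots> \<le> ennreal q'" using c by (rule ennreal_leI)
  finally show ?thesis using B I by (intro fails_leI[of "\<Union>i\<in>I. B i"]) auto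
qed

lemma fails_le_countable:
  fixes q :: "nat \<Rightarrow> real"
  assumes P: "\<And>i. fails_le M (q i) (P i)" and q: "\<And>i. q i \<ge> 0" "q sums Q"
  shows "fails_le M Q (\<lambda>X. \<forall>i. P i X)"
proof -
  obtain B where B: "\<And>i. B i \<in> sets M \<and> emeasure M (B i) \<le> ennreal (q i) \<and> (\<forall>X\<in>space M - B i. P i X)"
    using P unfolding fails_le_def by metis
  have "emeasure M (\<Union>i. B i) \<le> (\<Sum>i. emeasure M (B i))"
    using B by (intro emeasure_subadditive_countably) auto
  also have "\<dots> \<le> (\<Sum>i. ennreal (q i))" using B by (intro suminf_le) auto
  also have "\<dots> = ennreal Q" using q by (intro suminf_ennreal_eq)
  finally show ?thesis using B by (intro fails_leI[of "\<Union>i. B i"]) auto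
qed

context iso_log_concave
begin

text \<open>This is \<open>psi2_tail\<close> with the constant \<open>2 * \<delta>\<close>, which is
  admissible because it lies strictly above the psi-2 distance \<open>\<delta>\<close>. Admissible
  constants are positive, so \<open>\<delta> = 0\<close> is treated separately: the two vectors then
  agree on all \<open>n\<close> coordinates.\<close>

lemma fails_le_link:
  assumes L: "L \<ge> 0"
  shows "fails_le (PiM {..<N} (\<lambda>_. \<mu>)) (2 ^ N * exp (- L))
    (\<lambda>X. psi2_dist n \<mu> u v < top \<longrightarrow>
      L2_set (\<lambda>i. ip n (X i) (\<lambda>k. u k - v k)) {..<N} \<le> 2 * enn2real (psi2_dist n \<mu> u v) * sqrt L)"
proof -
  let ?M = "PiM {..<N} (\<lambda>_. \<mu>)"
  define \<delta> where "\<delta> = enn2real (psi2_dist n \<mu> u v)"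
  let ?f = "\<lambda>z. ip n (\<lambda>i. u i - v i) z"
  consider "psi2_dist n \<mu> u v = top" | "\<delta> = 0" "psi2_dist n \<mu> u v < top" | "\<delta> > 0" "psi2_dist n \<mu> u v < top"
  proof (cases "psi2_dist n \<mu> u v = top")
    case True
    then show ?thesis by (rule that(1))
  next
    case False
    then have fin: "psi2_dist n \<mu> u v < top" by (simp only: less_top[symmetric] not_False_eq_True)
    have "\<delta> = 0 \<or> \<delta> > 0" using enn2real_nonneg[of "psi2_dist n \<mu> u v"] unfolding \<delta>_def by linarith
    then show ?thesis using that(2,3) fin by blast
  qed
  then show ?thesis
  proof cases
    case 1
    then show ?thesis by (intro fails_leI[of "{}"]) auto
  next
    case 2
    then have "psi2_dist n \<mu> u v = 0" by (auto simp: \<delta>_def enn2real_eq_0_iff less_top)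
    then have e: "edist n u v = 0"
      using edist_le_psi2_dist[of u v] enorm_nonneg[of n "\<lambda>i. u i - v i"] by (simp add: edist_def)
    then have "u k = v k" if "k < n" for k
      using component_le_enorm[OF that, of "\<lambda>i. u i - v i"] by (simp add: edist_def)
    then have "ip n z (\<lambda>k. u k - v k) = 0" for z by (simp add: ip_def)
    then show ?thesis by (intro fails_leI[of "{}"]) (auto simp: L2_set_def L)
  next
    case 3
    let ?B = "{X \<in> space ?M. (2 * \<delta>)\<^sup>2 * L \<le> (\<Sum>i<N. (?f (X i))\<^sup>2)}"
    have "psi2_dist n \<mu> u v < ennreal (2 * \<delta>)"
      using 3 by (metis \<delta>_def ennreal_enn2real ennreal_lessI mult_2 less_add_same_cancel1 add_pos_pos)
    then have "psi2_adm \<mu> ?f (2 * \<delta>)"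
      unfolding psi2_dist_def by (rule psi2_less_imp_adm)
    then have "emeasure ?M ?B \<le> ennreal (2 ^ N * exp (- L))"
      by (intro psi2_tail[OF prob_mu]) auto
    moreover have "?B \<in> sets ?M" by measurable
    moreover have "L2_set (\<lambda>i. ip n (X i) (\<lambda>k. u k - v k)) {..<N} \<le> 2 * \<delta> * sqrt L"
      if "X \<in> space ?M" "X \<notin> ?B" for X
    proof -
      have "(\<Sum>i<N. (ip n (X i) (\<lambda>k. u k - v k))\<^sup>2) \<le> (2 * \<delta>)\<^sup>2 * L"
        using that by (simp add: ip_commute[of n _ "\<lambda>k. u k - v k"])
      then have "L2_set (\<lambda>i. ip n (X i) (\<lambda>k. u k - v k)) {..<N} \<le> sqrt ((2 * \<delta>)\<^sup>2 * L)"
        by (simp add: L2_set_def)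
      also have "\<dots> = 2 * \<delta> * sqrt L" using 3 by (simp add: real_sqrt_mult)
      finally show ?thesis .
    qed
    ultimately show ?thesis unfolding \<delta>_def[symmetric] by (intro fails_leI[of ?B]) auto
  qed
qed

text \<open>Chebyshev's inequality bounds the probability that one sample is large by
  \<open>(1 / A)\<^sup>2\<close>, and \<open>count_tail\<close> turns this into a bound for
  \<open>m\<close> large samples.\<close>

lemma fails_le_large:
  assumes A: "A > 0" and r: "r > 0" and y: "enorm n y \<le> r"
  shows "fails_le (PiM {..<N} (\<lambda>_. \<mu>)) (2 ^ N * ((1 / A)\<^sup>2) ^ m)
    (\<lambda>X. card {i. i < N \<and> A * r < \<bar>ip n (X i) y\<bar>} < m)"
proof -
  let ?M = "PiM {..<N} (\<lambda>_. \<mu>)"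
  let ?E = "{x \<in> space \<mu>. A * r < \<bar>ip n x y\<bar>}"
  let ?B = "{X \<in> space ?M. m \<le> card {i. i < N \<and> X i \<in> ?E}}"
  have E[measurable]: "?E \<in> sets \<mu>" by measurable
  have "measure \<mu> ?E \<le> (enorm n y / (A * r))\<^sup>2" using A r by (intro chebyshev) auto
  also have "\<dots> \<le> (1 / A)\<^sup>2" using A r y by (intro power_mono) (auto simp: field_simps)
  finally have "emeasure ?M ?B \<le> ennreal (2 ^ N * ((1 / A)\<^sup>2) ^ m)"
    using A by (intro count_tail[OF prob_mu E]) auto
  moreover have "?B \<in> sets ?M" by measurable
  moreover have "{i. i < N \<and> X i \<in> ?E} = {i. i < N \<and> A * r < \<bar>ip n (X i) y\<bar>}" if "X \<in> space ?M" for X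
    using that by (auto simp: space_PiM)
  ultimately show ?thesis by (intro fails_leI[of ?B]) auto
qed

text \<open>The counterpart of \<open>fails_le_large\<close> for small values, with
  \<open>small_ball\<close> in place of Chebyshev's inequality.\<close>

lemma fails_le_small:
  assumes y: "enorm n y > 0"
  shows "fails_le (PiM {..<N} (\<lambda>_. \<mu>)) (2 ^ N * ((4/5) ^ k) ^ m)
    (\<lambda>X. card {i. i < N \<and> \<bar>ip n (X i) y\<bar> \<le> enorm n y / 4 ^ k} < m)"
proof -
  let ?M = "PiM {..<N} (\<lambda>_. \<mu>)"
  let ?E = "{x \<in> space \<mu>. \<bar>ip n x y\<bar> \<le> enorm n y / 4 ^ k}"
  let ?B = "{X \<in> space ?M. m \<le> card {i. i < N \<and> X i \<in> ?E}}"
  have E[measurable]: "?E \<in> sets \<mu>" by measurable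
  have "emeasure ?M ?B \<le> ennreal (2 ^ N * ((4/5) ^ k) ^ m)"
    using small_ball[OF y] by (intro count_tail[OF prob_mu E]) auto
  moreover have "?B \<in> sets ?M" by measurable
  moreover have "{i. i < N \<and> X i \<in> ?E} = {i. i < N \<and> \<bar>ip n (X i) y\<bar> \<le> enorm n y / 4 ^ k}" if "X \<in> space ?M" for X
    using that by (auto simp: space_PiM)
  ultimately show ?thesis by (intro fails_leI[of ?B]) auto
qed

end

section \<open>Coverings of symmetric convex sets\<close>

definition sym_convex :: "(nat \<Rightarrow> real) set \<Rightarrow> bool" where
  "sym_convex S \<longleftrightarrow> (\<forall>x\<in>S. \<forall>y\<in>S. \<forall>t. 0 \<le> t \<and> t \<le> 1 \<longrightarrow> (\<lambda>i. t * x i + (1 - t) * y i) \<in> S)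
     \<and> (\<forall>x\<in>S. (\<lambda>i. - x i) \<in> S)"

lemma sym_convex_comb:
  assumes "sym_convex S" "x \<in> S" "y \<in> S" "0 \<le> t" "t \<le> 1"
  shows "(\<lambda>i. t * x i + (1 - t) * y i) \<in> S"
  using assms unfolding sym_convex_def by blast

lemma sym_convex_scale:
  assumes S: "sym_convex S" and x: "x \<in> S" and a: "\<bar>a\<bar> \<le> 1"
  shows "(\<lambda>i. a * x i) \<in> S"
proof -
  have "(\<lambda>i. - x i) \<in> S" using S x by (simp add: sym_convex_def)
  then have "(\<lambda>i. (1 + a) / 2 * x i + (1 - (1 + a) / 2) * - x i) \<in> S"
    using S x a by (intro sym_convex_comb[OF S]) auto
  moreover have "(\<lambda>i. (1 + a) / 2 * x i + (1 - (1 + a) / 2) * - x i) = (\<lambda>i. a * x i)"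
    by (auto simp: fun_eq_iff field_simps)
  ultimately show ?thesis by simp
qed

lemma sym_convex_half_diff:
  assumes S: "sym_convex S" and x: "x \<in> S" and y: "y \<in> S"
  shows "(\<lambda>i. (x i - y i) / 2) \<in> S"
proof -
  have "(\<lambda>i. - y i) \<in> S" using S y by (simp add: sym_convex_def)
  then have "(\<lambda>i. 1/2 * x i + (1 - 1/2) * - y i) \<in> S"
    using x by (intro sym_convex_comb[OF S]) auto
  then show ?thesis by (simp add: field_simps)
qed

text \<open>Scaling a point \<open>t\<close> of norm at most \<open>4 ^ Suc j * r\<close> into the
  ball of radius \<open>r\<close> assigns it a cell. Half the difference to a representative of that
  cell lies in \<open>S\<close> and has norm at most \<open>4 ^ j * r\<close>, so induction applies
  to it. Each step gains a factor 4 in the norm of \<open>t\<close> but only a factor 2 in front of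
  the remainder \<open>w\<close>.\<close>

lemma iterated_net:
  fixes \<phi> :: "(nat \<Rightarrow> real) \<Rightarrow> 'b"
  assumes S: "sym_convex S" and r: "r > 0" and F: "finite F"
    and \<phi>: "\<And>w. w \<in> S \<Longrightarrow> enorm n w \<le> r \<Longrightarrow> \<phi> w \<in> F"
    and cell: "\<And>w w'. w \<in> S \<Longrightarrow> enorm n w \<le> r \<Longrightarrow> w' \<in> S \<Longrightarrow> enorm n w' \<le> r \<Longrightarrow> \<phi> w = \<phi> w'
       \<Longrightarrow> enorm n (\<lambda>i. w i - w' i) \<le> r / 2"
  shows "\<exists>Z. finite Z \<and> card Z \<le> card F ^ j \<and> (\<forall>t\<in>S. enorm n t \<le> 4 ^ j * r \<longrightarrow>
     (\<exists>z\<in>Z. \<exists>w\<in>S. enorm n w \<le> r \<and> t = (\<lambda>i. z i + 2 ^ j * w i)))"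
proof (induction j)
  case 0
  show ?case by (intro exI[of _ "{\<lambda>i. 0}"]) auto
next
  case (Suc j)
  then obtain Z where Z: "finite Z" "card Z \<le> card F ^ j"
    and net: "\<And>t. t \<in> S \<Longrightarrow> enorm n t \<le> 4 ^ j * r \<Longrightarrow> \<exists>z\<in>Z. \<exists>w\<in>S. enorm n w \<le> r \<and> t = (\<lambda>i. z i + 2 ^ j * w i)"
    by blast
  define c :: real where "c = 1 / 4 ^ Suc j"
  have c: "0 < c" "c \<le> 1" using one_le_power[of "4::real" "Suc j"] by (auto simp: c_def field_simps)
  define Q where "Q = (\<lambda>f t. t \<in> S \<and> enorm n t \<le> 4 ^ Suc j * r \<and> \<phi> (\<lambda>i. c * t i) = f)"
  \<comment> \<open>One representative per cell, taken at the large scale. For an empty cell the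
    choice is arbitrary and merely adds to the count.\<close>
  define g where "g = (\<lambda>f. SOME t. Q f t)"
  let ?h = "\<lambda>(f, z). (\<lambda>i. g f i + 2 * z i)"
  let ?Z = "?h ` (F \<times> Z)"
  have "finite ?Z" using F Z by auto
  moreover have "card ?Z \<le> card F ^ Suc j"
  proof -
    have "card ?Z \<le> card (F \<times> Z)" using F Z by (intro card_image_le) auto
    also have "\<dots> \<le> card F * card F ^ j" using Z by (simp add: card_cartesian_product)
    finally show ?thesis by simp
  qed
  moreover have "\<exists>z\<in>?Z. \<exists>w\<in>S. enorm n w \<le> r \<and> t = (\<lambda>i. z i + 2 ^ Suc j * w i)"
    if t: "t \<in> S" "enorm n t \<le> 4 ^ Suc j * r" for t
  proof -
    have small: "(\<lambda>i. c * x i) \<in> S" "enorm n (\<lambda>i. c * x i) \<le> r"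
      if "x \<in> S" "enorm n x \<le> 4 ^ Suc j * r" for x
    proof -
      show "(\<lambda>i. c * x i) \<in> S" using that c by (intro sym_convex_scale[OF S]) auto
      have "c * enorm n x \<le> c * (4 ^ Suc j * r)" using that c by (intro mult_left_mono) auto
      also have "\<dots> = r" by (simp add: c_def)
      finally show "enorm n (\<lambda>i. c * x i) \<le> r" using c by (simp add: enorm_scale)
    qed
    define f where "f = \<phi> (\<lambda>i. c * t i)"
    have fF: "f \<in> F" unfolding f_def using small[OF t] by (rule \<phi>)
    have "Q f t" using t by (simp add: Q_def f_def)
    then have "Q f (g f)" unfolding g_def by (rule someI[where P = "Q f"])
    then have gf: "g f \<in> S" "enorm n (g f) \<le> 4 ^ Suc j * r" "\<phi> (\<lambda>i. c * g f i) = f"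
      by (simp_all add: Q_def)
    \<comment> \<open>Halving brings the difference back into \<open>S\<close> and supplies the
      second factor 2 in the norm; undoing it doubles \<open>z\<close> and the coefficient of
      \<open>w\<close>.\<close>
    define y where "y = (\<lambda>i. (t i - g f i) / 2)"
    have yS: "y \<in> S" unfolding y_def by (intro sym_convex_half_diff S t gf)
    have "enorm n (\<lambda>i. c * t i - c * g f i) \<le> r / 2"
      using small[OF t] small[OF gf(1,2)] gf(3) by (intro cell) (auto simp: f_def)
    moreover have "(\<lambda>i. c * t i - c * g f i) = (\<lambda>i. (2 * c) * y i)"
      by (auto simp: y_def fun_eq_iff algebra_simps)
    ultimately have "2 * c * enorm n y \<le> r / 2" using c by (simp add: enorm_scale)
    then have "enorm n y \<le> 4 ^ j * r" by (simp add: c_def field_simps)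
    then obtain z w where zw: "z \<in> Z" "w \<in> S" "enorm n w \<le> r" "y = (\<lambda>i. z i + 2 ^ j * w i)"
      using net[OF yS] by blast
    have "t i = g f i + 2 * z i + 2 ^ Suc j * w i" for i
      using fun_cong[OF zw(4), of i] by (simp add: y_def field_simps)
    then have "t = (\<lambda>i. ?h (f, z) i + 2 ^ Suc j * w i)" by auto
    moreover have "?h (f, z) \<in> ?Z" using fF zw by blast
    ultimately show ?thesis using zw by blast
  qed
  ultimately show ?case by blast
qed

text \<open>The midpoint of \<open>v\<close> and \<open>w\<close> has norm between
  \<open>3/2 * r\<close> and \<open>5/2 * r\<close>, so shrinking it to norm \<open>r\<close> stays
  in \<open>S\<close>. Solving for \<open>w\<close> gives \<open>b\<close> as twice the norm of the
  midpoint divided by \<open>r\<close>. In this way sphere data control the whole ball.\<close>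

lemma ball_from_sphere:
  assumes S: "sym_convex S" and r: "r > 0" and v: "v \<in> S" "enorm n v = 4 * r"
    and w: "w \<in> S" "enorm n w \<le> r"
  shows "\<exists>b p. 3 \<le> b \<and> b \<le> 5 \<and> p \<in> S \<and> enorm n p = r \<and> w = (\<lambda>i. b * p i - v i)"
proof -
  define y where "y = (\<lambda>i. 1/2 * v i + (1 - 1/2) * w i)"
  have y: "y \<in> S" unfolding y_def by (intro sym_convex_comb[OF S] v w) auto
  have "enorm n (\<lambda>i. 2 * y i) \<le> 5 * r"
    using enorm_add[of n v w] v w by (simp add: y_def distrib_left)
  moreover have "3 * r \<le> enorm n (\<lambda>i. 2 * y i)"
    using enorm_diff_ge[of n v "\<lambda>i. - w i"] v w by (simp add: y_def distrib_left enorm_minus)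
  ultimately have ny: "2 * enorm n y \<le> 5 * r" "3 * r \<le> 2 * enorm n y" by (simp_all add: enorm_scale)
  define p where "p = (\<lambda>i. r / enorm n y * y i)"
  have pos: "enorm n y > 0" using ny r by linarith
  have "p \<in> S" unfolding p_def using ny r pos by (intro sym_convex_scale[OF S] y) auto
  moreover have "enorm n p = r" unfolding p_def enorm_scale[of n "r / enorm n y" y] using pos r by simp
  moreover have "w = (\<lambda>i. 2 * enorm n y / r * p i - v i)"
    using pos r by (auto simp: p_def y_def fun_eq_iff)
  ultimately show ?thesis using ny r
    by (intro exI[of _ "2 * enorm n y / r"] exI[of _ p]) (auto simp: field_simps)
qed

section \<open>Kernel points of a given norm\<close>

text \<open>Reduces the union bounds below to linear inequalities between exponents.\<close>

lemma half_power_bound: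
  fixes a c d :: nat
  assumes "a + c \<le> d"
  shows "2 ^ a * (1/2) ^ d \<le> (1/2 :: real) ^ c"
proof -
  obtain e where e: "d = a + c + e" using assms le_Suc_ex by blast
  have "2 ^ a * (1/2 :: real) ^ d = (2 * (1/2)) ^ a * (1/2) ^ c * (1/2) ^ e"
    by (simp only: e power_add power_mult_distrib mult_ac)
  also have "\<dots> \<le> (1/2) ^ c" by (simp add: mult_left_le power_le_one)
  finally show ?thesis .
qed

lemma exp_minus_le_half_power: "exp (- real m) \<le> (1/2) ^ m"
proof -
  have "2 \<le> exp (1::real)" using exp_ge_add_one_self[of 1] by simp
  then have "exp (-1::real) \<le> 1/2" by (simp add: exp_minus field_simps)
  then have "exp (-1::real) ^ m \<le> (1/2) ^ m" by (intro power_mono) auto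
  then show ?thesis by (simp add: exp_of_nat_mult[symmetric])
qed

text \<open>The output of \<open>gamma2_chain\<close> for the points of norm \<open>r\<close>,
  carried over to all of \<open>S\<close>. The starting level \<open>s0\<close> makes
  \<open>2 ^ s0\<close> a small multiple of \<open>N\<close>: a union over \<open>Ts s0\<close>
  costs at most \<open>2 ^ (N / 128)\<close>, yet \<open>sqrt N\<close> is still at most 16 times
  the chaining weight at level \<open>s0\<close>.\<close>

locale chained_section = iso_log_concave n \<mu> for n \<mu> +
  fixes S :: "(nat \<Rightarrow> real) set" and r G :: real and N s0 :: nat
    and Ts :: "nat \<Rightarrow> (nat \<Rightarrow> real) set" and \<pi> :: "nat \<Rightarrow> (nat \<Rightarrow> real) \<Rightarrow> nat \<Rightarrow> real"
    and a :: "nat \<Rightarrow> (nat \<Rightarrow> real) \<Rightarrow> real"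
  assumes S: "sym_convex S" and r: "r > 0"
    and Ts_finite: "\<And>s. finite (Ts s)" and Ts_card: "\<And>s. card (Ts s) \<le> 2 ^ (2 ^ s)"
    and Ts_norm: "\<And>s u. u \<in> Ts s \<Longrightarrow> enorm n u \<le> r"
    and pi_in: "\<And>s p. p \<in> S \<Longrightarrow> enorm n p = r \<Longrightarrow> \<pi> s p \<in> Ts s"
    and pi_dist: "\<And>s p. p \<in> S \<Longrightarrow> enorm n p = r \<Longrightarrow> psi2_dist n \<mu> p (\<pi> s p) = ennreal (a s p)"
    and a_nonneg: "\<And>s p. 0 \<le> a s p"
    and a_sum: "\<And>m p. p \<in> S \<Longrightarrow> enorm n p = r \<Longrightarrow> (\<Sum>s<m. 2 powr (real s / 2) * a s p) \<le> G"
    and G: "G = r * sqrt (real N) / 1000"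
    and s0: "128 * 2 ^ s0 \<le> N" "N < 256 * 2 ^ s0" and N: "1000000 \<le> N"
begin

abbreviation M :: "(nat \<Rightarrow> nat \<Rightarrow> real) measure" where
  "M \<equiv> PiM {..<N} (\<lambda>_. \<mu>)"

lemma edist_pi_le: "p \<in> S \<Longrightarrow> enorm n p = r \<Longrightarrow> edist n p (\<pi> s p) \<le> a s p"
  using edist_le_psi2_dist[of p "\<pi> s p"] a_nonneg[of s p] by (simp add: pi_dist)

lemma a_le:
  assumes "p \<in> S" "enorm n p = r"
  shows "2 powr (real s / 2) * a s p \<le> G"
proof -
  have "2 powr (real s / 2) * a s p \<le> (\<Sum>s<Suc s. 2 powr (real s / 2) * a s p)"
    by (rule member_le_sum) (auto simp: a_nonneg)
  also have "\<dots> \<le> G" by (rule a_sum[OF assms])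
  finally show ?thesis .
qed

section \<open>Exceptional events at one scale\<close>

text \<open>Union bound over \<open>Ts s0\<close>. More than \<open>N / 8\<close> large samples at
  threshold \<open>4 ^ l * r\<close> contribute a factor of at most
  \<open>(1/2) ^ (l * N / 2)\<close>, which outweighs both \<open>2 ^ N\<close> and the number of
  vertices because \<open>l\<close> is at least 20.\<close>

lemma fails_le_vertices:
  assumes l: "20 \<le> l"
  shows "fails_le M ((1/2) ^ (10 * l))
    (\<lambda>X. \<forall>u\<in>Ts s0. card {i. i < N \<and> 4 ^ l * r < \<bar>ip n (X i) u\<bar>} < N div 8 + 1)"
proof (rule fails_le_finite)
  let ?m = "N div 8 + 1"
  let ?q = "2 ^ N * ((1 / 4 ^ l)\<^sup>2) ^ ?m :: real"
  show "fails_le M ?q (\<lambda>X. card {i. i < N \<and> 4 ^ l * r < \<bar>ip n (X i) u\<bar>} < ?m)" if "u \<in> Ts s0" for u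
    by (rule fails_le_large) (auto simp: r Ts_norm[OF that])
  have "N \<le> 8 * ?m" by presburger
  then have "l * N \<le> l * (8 * ?m)" by (rule mult_le_mono2)
  moreover have "20 * N \<le> l * N" "l * 1000000 \<le> l * N" using l N by auto
  ultimately have le: "(2 ^ s0 + N) + 10 * l \<le> 4 * l * ?m" using s0 by linarith
  have "((1 / 4 ^ l)\<^sup>2 :: real) = 1 / 2 ^ (4 * l)"
  proof -
    have "(4 ^ l)\<^sup>2 = ((4 * 4) ^ l :: real)" by (simp only: power2_eq_square power_mult_distrib)
    also have "\<dots> = (2 ^ 4) ^ l" by simp
    finally show ?thesis by (simp only: power_divide power_mult power_one)
  qed
  then have "((1 / 4 ^ l)\<^sup>2 :: real) = (1/2) ^ (4 * l)" by (simp only: power_one_over)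
  then have "?q = 2 ^ N * (1/2) ^ (4 * l * ?m)" by (simp only: power_mult)
  then have "real (card (Ts s0)) * ?q \<le> 2 ^ (2 ^ s0) * (2 ^ N * (1/2) ^ (4 * l * ?m))"
    using of_nat_mono[OF Ts_card[of s0], where 'a = real] by (simp only:) (intro mult_right_mono, auto)
  also have "\<dots> = 2 ^ (2 ^ s0 + N) * (1/2) ^ (4 * l * ?m)" by (simp only: power_add mult.assoc)
  also have "\<dots> \<le> (1/2) ^ (10 * l)" by (rule half_power_bound[OF le])
  finally show "real (card (Ts s0)) * ?q \<le> (1/2) ^ (10 * l)" .
qed (auto simp: Ts_finite)

text \<open>At level \<open>s\<close> there are at most \<open>2 ^ (3 * 2 ^ s)\<close> links, so a
  deviation parameter proportional to \<open>2 ^ s\<close> beats the union bound. The extra factor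
  \<open>(1/2) ^ k\<close> makes the levels summable.\<close>

lemma fails_le_chain:
  assumes l: "20 \<le> l"
  shows "fails_le M ((1/2) ^ (10 * l) * 2)
    (\<lambda>X. \<forall>k. \<forall>(u, v)\<in>Ts (s0 + k) \<times> Ts (Suc (s0 + k)). psi2_dist n \<mu> u v < top \<longrightarrow>
      L2_set (\<lambda>i. ip n (X i) (\<lambda>j. u j - v j)) {..<N}
        \<le> 2 * enn2real (psi2_dist n \<mu> u v) * sqrt (real ((260 + l) * 2 ^ (s0 + k))))"
proof (rule fails_le_countable)
  have "(\<lambda>k. (1/2 :: real) ^ (10 * l) * (1/2) ^ k) sums ((1/2) ^ (10 * l) * (1 / (1 - 1/2)))"
    by (intro sums_mult geometric_sums) simp
  then show "(\<lambda>k. (1/2 :: real) ^ (10 * l) * (1/2) ^ k) sums ((1/2) ^ (10 * l) * 2)" by simp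
  fix k
  define s where "s = s0 + k"
  define L where "L = (260 + l) * 2 ^ s"
  let ?P = "\<lambda>u v X. psi2_dist n \<mu> u v < top \<longrightarrow>
      L2_set (\<lambda>i. ip n (X i) (\<lambda>j. u j - v j)) {..<N} \<le> 2 * enn2real (psi2_dist n \<mu> u v) * sqrt (real L)"
  have "fails_le M ((1/2) ^ (10 * l) * (1/2) ^ k) (\<lambda>X. \<forall>w\<in>Ts s \<times> Ts (Suc s). ?P (fst w) (snd w) X)"
  proof (rule fails_le_finite)
    show "fails_le M (2 ^ N * exp (- real L)) (?P (fst w) (snd w))" for w
      by (rule fails_le_link) simp
    have "k < 2 ^ k" by simp
    moreover have "(2::nat) ^ s = 2 ^ s0 * 2 ^ k" by (simp add: s_def power_add)
    moreover have "(1::nat) \<le> 2 ^ k" "(10::nat) \<le> 2 ^ s0" using s0 N by auto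
    then have "(2::nat) ^ s0 * 1 \<le> 2 ^ s0 * 2 ^ k" "10 * 2 ^ k \<le> (2::nat) ^ s0 * 2 ^ k"
      by (intro mult_le_mono; simp)+
    ultimately have s: "2 ^ s0 \<le> (2::nat) ^ s" "k \<le> 2 ^ s" by linarith+
    then have "l * 10 \<le> l * 2 ^ s" using \<open>10 \<le> 2 ^ s0\<close> by (intro mult_le_mono2) linarith
    \<comment> \<open>Here 260 is 256 + 3 + 1: the factor \<open>2 ^ N\<close> costs at most
      \<open>256 * 2 ^ s\<close>, the links cost \<open>3 * 2 ^ s\<close> and \<open>k\<close> is at
      most \<open>2 ^ s\<close>. The part \<open>l * 2 ^ s\<close> covers
      \<open>10 * l\<close>.\<close>
    moreover have "L = 260 * 2 ^ s + l * 2 ^ s" by (simp add: L_def algebra_simps)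
    ultimately have le: "(2 ^ s + 2 * 2 ^ s + N) + (10 * l + k) \<le> L"
      using s s0 by linarith
    have "card (Ts s \<times> Ts (Suc s)) \<le> 2 ^ (2 ^ s) * 2 ^ (2 ^ Suc s)"
      unfolding card_cartesian_product by (intro mult_le_mono Ts_card)
    then have "real (card (Ts s \<times> Ts (Suc s))) \<le> real (2 ^ (2 ^ s) * 2 ^ (2 ^ Suc s))"
      by (rule of_nat_mono)
    also have "\<dots> = 2 ^ (2 ^ s + 2 * 2 ^ s)"
      by (simp only: power_Suc of_nat_mult of_nat_power of_nat_numeral power_add)
    finally have "real (card (Ts s \<times> Ts (Suc s))) * (2 ^ N * exp (- real L))
        \<le> 2 ^ (2 ^ s + 2 * 2 ^ s) * (2 ^ N * (1/2) ^ L)"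
      using exp_minus_le_half_power[of L] by (intro mult_mono) auto
    also have "\<dots> = 2 ^ (2 ^ s + 2 * 2 ^ s + N) * (1/2) ^ L" by (simp only: power_add mult.assoc)
    also have "\<dots> \<le> (1/2) ^ (10 * l + k)" by (rule half_power_bound[OF le])
    finally show "real (card (Ts s \<times> Ts (Suc s))) * (2 ^ N * exp (- real L)) \<le> (1/2) ^ (10 * l) * (1/2) ^ k"
      by (simp only: power_add)
  qed (auto simp: Ts_finite)
  then show "fails_le M ((1/2) ^ (10 * l) * (1/2) ^ k)
    (\<lambda>X. \<forall>(u, v)\<in>Ts (s0 + k) \<times> Ts (Suc (s0 + k)). psi2_dist n \<mu> u v < top \<longrightarrow>
      L2_set (\<lambda>i. ip n (X i) (\<lambda>j. u j - v j)) {..<N}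
        \<le> 2 * enn2real (psi2_dist n \<mu> u v) * sqrt (real ((260 + l) * 2 ^ (s0 + k))))"
    by (simp add: s_def L_def case_prod_beta)
qed simp

text \<open>The logarithm of the size of \<open>Z\<close> is of order \<open>l * 2 ^ s0\<close>,
  hence a small multiple of \<open>l * N\<close>, while the small ball estimate on half of the
  samples gives \<open>(4/5) ^ ((l - 3) * N / 2)\<close>. The bound 41 is absorbed into
  \<open>2 ^ 6\<close>.\<close>

lemma fails_le_net:
  assumes l: "20 \<le> l" and Z: "finite Z" "card Z \<le> (41 * 2 ^ (2 ^ s0)) ^ (4 * l)"
  shows "fails_le M ((1/2) ^ (10 * l)) (\<lambda>X. \<forall>z\<in>Z. enorm n z > 0 \<longrightarrow>
     card {i. i < N \<and> \<bar>ip n (X i) z\<bar> \<le> enorm n z / 4 ^ (l - 3)} < (N + 1) div 2)"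
proof (rule fails_le_finite[OF Z(1)])
  let ?m = "(N + 1) div 2"
  let ?q = "2 ^ N * ((4/5) ^ (l - 3)) ^ ?m :: real"
  show "fails_le M ?q (\<lambda>X. enorm n z > 0 \<longrightarrow>
     card {i. i < N \<and> \<bar>ip n (X i) z\<bar> \<le> enorm n z / 4 ^ (l - 3)} < ?m)" for z
  proof (cases "enorm n z > 0")
    case True
    then show ?thesis using fails_le_small[OF True, of N "l - 3" ?m] by simp
  next
    case False
    then show ?thesis by (intro fails_leI[of "{}"]) auto
  qed
  have "N \<le> 2 * ?m" by presburger
  then have "(l - 3) * N \<le> (l - 3) * (2 * ?m)" by (rule mult_le_mono2)
  then have "(l - 3) * N \<le> 2 * ((l - 3) * ?m)" by (simp only: mult.left_commute)
  moreover have "l * N = (l - 3) * N + 3 * N" using l by (simp add: diff_mult_distrib)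
  moreover have "20 * N \<le> l * N" "l * 1000000 \<le> l * N" using l N by auto
  moreover have "l * (128 * 2 ^ s0) \<le> l * N" using s0 by (intro mult_le_mono2)
  then have "128 * (l * 2 ^ s0) \<le> l * N" by (simp only: mult.left_commute)
  moreover have "4 * ((6 + 2 ^ s0) * (4 * l) + N) + 4 * (10 * l) = 136 * l + 16 * (l * 2 ^ s0) + 4 * N"
    by (simp add: algebra_simps)
  ultimately have le: "4 * ((6 + 2 ^ s0) * (4 * l) + N) + 4 * (10 * l) \<le> (l - 3) * ?m"
    by linarith
  have cZ: "real (card Z) \<le> 2 ^ ((6 + 2 ^ s0) * (4 * l))"
  proof -
    have "real (card Z) \<le> real ((41 * 2 ^ (2 ^ s0)) ^ (4 * l))" using Z(2) by (rule of_nat_mono)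
    also have "\<dots> \<le> (2 ^ (6 + 2 ^ s0)) ^ (4 * l)"
      unfolding of_nat_power by (intro power_mono) (auto simp: power_add)
    finally show ?thesis by (simp only: power_mult)
  qed
  \<comment> \<open>fourth powers, since \<open>(4/5) ^ 4 \<le> 1/2\<close>\<close>
  have "(real (card Z) * ?q) ^ 4 \<le> ((1/2) ^ (10 * l)) ^ 4"
  proof -
    have "real (card Z) * ?q \<le> 2 ^ ((6 + 2 ^ s0) * (4 * l)) * ?q"
      using cZ by (intro mult_right_mono) auto
    then have "(real (card Z) * ?q) ^ 4 \<le> (2 ^ ((6 + 2 ^ s0) * (4 * l)) * ?q) ^ 4"
      by (intro power_mono) auto
    also have "\<dots> = 2 ^ (4 * ((6 + 2 ^ s0) * (4 * l) + N)) * ((4/5) ^ 4) ^ ((l - 3) * ?m)"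
    proof -
      have "(((4/5 :: real) ^ (l - 3)) ^ ?m) ^ 4 = ((4/5) ^ 4) ^ ((l - 3) * ?m)"
        by (simp only: power_mult[symmetric] mult_ac)
      moreover have "(2 ^ ((6 + 2 ^ s0) * (4 * l)) * 2 ^ N :: real) ^ 4 = 2 ^ (4 * ((6 + 2 ^ s0) * (4 * l) + N))"
        by (simp only: power_add[symmetric] power_mult[symmetric] ac_simps)
      ultimately show ?thesis by (simp only: mult.assoc[symmetric] power_mult_distrib[of _ _ 4])
    qed
    also have "\<dots> \<le> 2 ^ (4 * ((6 + 2 ^ s0) * (4 * l) + N)) * (1/2) ^ ((l - 3) * ?m)"
      by (intro mult_left_mono power_mono) (auto simp: power_divide)
    also have "\<dots> \<le> (1/2) ^ (4 * (10 * l))" by (rule half_power_bound[OF le])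
    finally show ?thesis by (simp only: power_mult[symmetric] mult.commute)
  qed
  then show "real (card Z) * ?q \<le> (1/2) ^ (10 * l)"
    by (subst (asm) power_mono_iff) auto
qed auto

section \<open>Deterministic consequences of the good events\<close>

text \<open>Telescoping along the chain from level \<open>s0\<close>: the root of the deviation
  parameter is \<open>sqrt B\<close> times the weight \<open>2 powr (s / 2)\<close>, so the links
  sum to a multiple of \<open>G\<close>. The two distances in each link yield two such sums.\<close>

lemma chain_remainder:
  assumes p: "p \<in> S" "enorm n p = r"
    and link: "\<And>k u v. u \<in> Ts (s0 + k) \<Longrightarrow> v \<in> Ts (Suc (s0 + k)) \<Longrightarrow> psi2_dist n \<mu> u v < top \<Longrightarrow>
      L2_set (\<lambda>i. ip n (X i) (\<lambda>j. u j - v j)) {..<N}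
        \<le> 2 * enn2real (psi2_dist n \<mu> u v) * sqrt (B * 2 ^ (s0 + k))"
    and B: "B \<ge> 0"
  shows "L2_set (\<lambda>i. ip n (X i) (\<lambda>j. p j - \<pi> s0 p j)) {..<N} \<le> 8 * sqrt B * G"
proof -
  define f where "f = (\<lambda>s. 2 powr (real s / 2) * a s p)"
  define D where "D = (\<lambda>m. L2_set (\<lambda>i. ip n (X i) (\<lambda>j. \<pi> s0 p j - \<pi> (s0 + m) p j)) {..<N})"
  have f0: "f s \<ge> 0" for s by (simp add: f_def a_nonneg)
  have step: "L2_set (\<lambda>i. ip n (X i) (\<lambda>j. \<pi> (s0 + k) p j - \<pi> (Suc (s0 + k)) p j)) {..<N}
     \<le> 4 * sqrt B * (f (s0 + k) + f (Suc (s0 + k)))" for k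
  proof -
    let ?s = "s0 + k"
    let ?d = "psi2_dist n \<mu> (\<pi> ?s p) (\<pi> (Suc ?s) p)"
    have d: "?d \<le> ennreal (2 * (a ?s p + a (Suc ?s) p))"
      by (rule psi2_dist_link[OF pi_dist[OF p] pi_dist[OF p] a_nonneg a_nonneg])
    then have fin: "?d < top" using ennreal_less_top by (rule le_less_trans)
    have dr: "enn2real ?d \<le> 2 * (a ?s p + a (Suc ?s) p)"
      using d by (intro enn2real_leI) (auto simp: a_nonneg)
    have sq: "sqrt (B * 2 ^ ?s) = sqrt B * 2 powr (real ?s / 2)"
      by (simp add: real_sqrt_mult powr_half_sqrt[symmetric] powr_realpow[symmetric] powr_powr)
    have "L2_set (\<lambda>i. ip n (X i) (\<lambda>j. \<pi> ?s p j - \<pi> (Suc ?s) p j)) {..<N} \<le> 2 * enn2real ?d * sqrt (B * 2 ^ ?s)"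
      by (rule link[OF pi_in[OF p] pi_in[OF p] fin])
    also have "\<dots> \<le> 2 * (2 * (a ?s p + a (Suc ?s) p)) * (sqrt B * 2 powr (real ?s / 2))"
      unfolding sq using dr B by (intro mult_right_mono mult_left_mono) auto
    also have "\<dots> = 4 * sqrt B * (f ?s + 2 powr (real ?s / 2) * a (Suc ?s) p)"
      by (simp add: f_def algebra_simps)
    \<comment> \<open>The distance at level \<open>Suc ?s\<close> comes with the smaller weight of
      level \<open>?s\<close>, which is enlarged to its own.\<close>
    also have "\<dots> \<le> 4 * sqrt B * (f ?s + f (Suc ?s))"
      unfolding f_def using B a_nonneg by (intro mult_left_mono add_left_mono mult_right_mono powr_mono) auto
    finally show ?thesis .
  qed
  have "D m \<le> (\<Sum>k<m. 4 * sqrt B * (f (s0 + k) + f (Suc (s0 + k))))" for m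
  proof (induction m)
    case 0
    show ?case by (simp add: D_def L2_set_def ip_def)
  next
    case (Suc m)
    have "D (Suc m) = L2_set (\<lambda>i. ip n (X i) (\<lambda>j. \<pi> s0 p j - \<pi> (s0 + m) p j)
        + ip n (X i) (\<lambda>j. \<pi> (s0 + m) p j - \<pi> (Suc (s0 + m)) p j)) {..<N}"
      by (simp add: D_def ip_diff)
    also have "\<dots> \<le> D m + L2_set (\<lambda>i. ip n (X i) (\<lambda>j. \<pi> (s0 + m) p j - \<pi> (Suc (s0 + m)) p j)) {..<N}"
      unfolding D_def by (rule L2_set_triangle_ineq)
    finally show ?case using Suc step[of m] by simp
  qed
  moreover have "(\<Sum>k<m. 4 * sqrt B * (f (s0 + k) + f (Suc (s0 + k)))) \<le> 8 * sqrt B * G" for m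
  proof -
    have shift: "(\<Sum>k<m. f (c + k)) \<le> G" for c
    proof -
      have "(\<Sum>k<m. f (c + k)) = sum f ((+) c ` {..<m})" by (subst sum.reindex) auto
      also have "\<dots> \<le> sum f {..<c + m}" using f0 by (intro sum_mono2) auto
      also have "\<dots> \<le> G" unfolding f_def by (rule a_sum[OF p])
      finally show ?thesis .
    qed
    have "(\<Sum>k<m. 4 * sqrt B * (f (s0 + k) + f (Suc (s0 + k))))
        = 4 * sqrt B * ((\<Sum>k<m. f (s0 + k)) + (\<Sum>k<m. f (Suc s0 + k)))"
      by (simp add: sum_distrib_left sum.distrib distrib_left)
    also have "\<dots> \<le> 4 * sqrt B * (G + G)"
      using B by (intro mult_left_mono add_mono shift) auto
    finally show ?thesis by simp
  qed
  ultimately have D: "D m \<le> 8 * sqrt B * G" for m by (rule order_trans)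
  \<comment> \<open>Each term of the chaining sum is at most \<open>G\<close>, so the distances
    \<open>a\<close> decay geometrically. Convergence of the first \<open>n\<close> coordinates
    suffices, as \<open>ip n\<close> sees only these.\<close>
  have conv: "(\<lambda>m. \<pi> (s0 + m) p j) \<longlonglongrightarrow> p j" if "j < n" for j
  proof (rule LIM_zero_cancel, rule Lim_null_comparison)
    have "norm (\<pi> (s0 + m) p j - p j) \<le> G * (2 powr (- (1/2))) ^ m" for m
    proof -
      have "norm (\<pi> (s0 + m) p j - p j) \<le> edist n p (\<pi> (s0 + m) p)"
        using component_le_enorm[OF that, of "\<lambda>i. p i - \<pi> (s0 + m) p i"] by (simp add: edist_def abs_minus_commute)
      also have "\<dots> \<le> a (s0 + m) p" by (rule edist_pi_le[OF p])
      also have "\<dots> \<le> G * 2 powr (- (real m / 2))"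
      proof -
        have "2 powr (real m / 2) * a (s0 + m) p \<le> 2 powr (real (s0 + m) / 2) * a (s0 + m) p"
          using a_nonneg by (intro mult_right_mono powr_mono) auto
        also have "\<dots> \<le> G" by (rule a_le[OF p])
        finally show ?thesis by (simp add: powr_minus field_simps)
      qed
      also have "2 powr (- (real m / 2)) = (2 powr (- (1/2))) ^ m"
        by (subst powr_realpow[symmetric]) (auto simp: powr_powr)
      finally show ?thesis .
    qed
    then show "\<forall>\<^sub>F m in sequentially. norm (\<pi> (s0 + m) p j - p j) \<le> G * (2 powr (- (1/2))) ^ m" by simp
    have "(2::real) powr (- (1/2)) < 2 powr 0" by (intro powr_less_mono) auto
    then have "(\<lambda>m. (2 powr (- (1/2))) ^ m) \<longlonglongrightarrow> (0::real)"
      by (intro LIMSEQ_realpow_zero) auto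
    then show "(\<lambda>m. G * (2 powr (- (1/2))) ^ m) \<longlonglongrightarrow> 0" by (rule tendsto_mult_right_zero)
  qed
  have "D \<longlonglongrightarrow> L2_set (\<lambda>i. ip n (X i) (\<lambda>j. \<pi> s0 p j - p j)) {..<N}"
    unfolding D_def L2_set_def ip_def by (intro tendsto_intros conv) auto
  then have "L2_set (\<lambda>i. ip n (X i) (\<lambda>j. \<pi> s0 p j - p j)) {..<N} \<le> 8 * sqrt B * G"
    using D by (intro LIMSEQ_le_const2[of D]) auto
  moreover have "L2_set (\<lambda>i. ip n (X i) (\<lambda>j. \<pi> s0 p j - p j)) {..<N}
      = L2_set (\<lambda>i. ip n (X i) (\<lambda>j. p j - \<pi> s0 p j)) {..<N}"
    by (simp add: L2_set_def ip_diff power2_commute)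
  ultimately show ?thesis by simp
qed

text \<open>A value above \<open>2 * 4 ^ l * r\<close> forces the vertex part or the remainder above
  \<open>4 ^ l * r\<close>. The first happens for at most \<open>N / 8\<close> indices by
  assumption, the second for at most \<open>N / 8\<close> by counting against the
  \<open>L2_set\<close> bound.\<close>

lemma card_large_le:
  assumes p: "p \<in> S" "enorm n p = r"
    and vertex: "card {i. i < N \<and> 4 ^ l * r < \<bar>ip n (X i) (\<pi> s0 p)\<bar>} < N div 8 + 1"
    and rem: "L2_set (\<lambda>i. ip n (X i) (\<lambda>j. p j - \<pi> s0 p j)) {..<N} \<le> 8 * sqrt (260 + real l) * G"
  shows "4 * card {i. i < N \<and> 2 * 4 ^ l * r < \<bar>ip n (X i) p\<bar>} \<le> N"
proof -
  let ?q = "\<lambda>j. p j - \<pi> s0 p j"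
  let ?V = "{i. i < N \<and> 4 ^ l * r < \<bar>ip n (X i) (\<pi> s0 p)\<bar>}"
  let ?W = "{i. i < N \<and> 4 ^ l * r < \<bar>ip n (X i) ?q\<bar>}"
  have "real (card ?W) * (4 ^ l * r)\<^sup>2 = (\<Sum>i\<in>?W. (4 ^ l * r)\<^sup>2)" by simp
  also have "\<dots> \<le> (\<Sum>i\<in>?W. (ip n (X i) ?q)\<^sup>2)"
    using r by (intro sum_mono) (auto simp: abs_le_square_iff[symmetric])
  also have "\<dots> \<le> (\<Sum>i<N. (ip n (X i) ?q)\<^sup>2)" by (intro sum_mono2) auto
  also have "\<dots> = (L2_set (\<lambda>i. ip n (X i) ?q) {..<N})\<^sup>2" by (simp add: L2_set_def sum_nonneg)
  also have "\<dots> \<le> (8 * sqrt (260 + real l) * G)\<^sup>2" using rem by (intro power_mono) auto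
  also have "\<dots> = 64 * (260 + real l) * r\<^sup>2 * N / 1000000"
    by (simp add: G power_mult_distrib power_divide)
  finally have "real (card ?W) * 16 ^ l * r\<^sup>2 \<le> 64 * (260 + real l) * N / 1000000 * r\<^sup>2"
  proof -
    have "(4 ^ l * r)\<^sup>2 = 16 ^ l * r\<^sup>2" 
    proof -
      have "(4 ^ l)\<^sup>2 = ((4 * 4) ^ l :: real)" by (simp only: power2_eq_square power_mult_distrib)
      also have "\<dots> = 16 ^ l" by simp
      finally show ?thesis by (simp only: power_mult_distrib)
    qed
    then show ?thesis if "real (card ?W) * (4 ^ l * r)\<^sup>2 \<le> 64 * (260 + real l) * r\<^sup>2 * N / 1000000"
      using that by (simp add: mult_ac)
  qed
  then have W: "real (card ?W) * 16 ^ l \<le> 64 * (260 + real l) * N / 1000000"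
    using r by (simp add: mult_le_cancel_right)
  have l16: "512 * (260 + real l) / 1000000 \<le> 16 ^ l"
  proof -
    have "real l < 2 ^ l" by (rule of_nat_less_two_power)
    also have "\<dots> \<le> 16 ^ l" by (rule power_mono) auto
    finally have "real l \<le> 16 ^ l" by simp
    moreover have "1 \<le> (16::real) ^ l" by simp
    moreover have "512 * (260 + x) / 1000000 \<le> y" if "x \<le> y" "1 \<le> y" for x y :: real
      using that by simp
    ultimately show ?thesis by blast
  qed
  have "8 * (real (card ?W) * 16 ^ l) \<le> 8 * (64 * (260 + real l) * N / 1000000)"
    using W by (intro mult_left_mono) auto
  also have "\<dots> = 512 * (260 + real l) / 1000000 * real N" by simp
  also have "\<dots> \<le> 16 ^ l * real N" using l16 by (intro mult_right_mono) auto
  finally have "16 ^ l * (8 * real (card ?W)) \<le> 16 ^ l * real N" by (simp only: mult_ac)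
  then have "8 * real (card ?W) \<le> real N" by (rule mult_left_le_imp_le) simp
  then have "8 * card ?W \<le> N" by linarith
  moreover have "8 * card ?V \<le> N" using vertex by linarith
  moreover have "card {i. i < N \<and> 2 * 4 ^ l * r < \<bar>ip n (X i) p\<bar>} \<le> card (?V \<union> ?W)"
    by (intro card_mono) (auto simp: ip_diff)
  moreover have "card (?V \<union> ?W) \<le> card ?V + card ?W" by (rule card_Un_le)
  ultimately show ?thesis by linarith
qed

text \<open>Supplies the cells for \<open>iterated_net\<close>: by \<open>ball_from_sphere\<close> a
  point of the ball is determined by a number \<open>b\<close> in [3, 5] and a point
  \<open>p\<close> of norm \<open>r\<close>, which are discretized separately.\<close>

lemma covering_net:
  assumes v: "v \<in> S" "enorm n v = 4 * r"
  shows "\<exists>Z. finite Z \<and> card Z \<le> (41 * 2 ^ (2 ^ s0)) ^ j \<and> (\<forall>t\<in>S. enorm n t \<le> 4 ^ j * r \<longrightarrow>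
     (\<exists>z\<in>Z. \<exists>w\<in>S. enorm n w \<le> r \<and> t = (\<lambda>i. z i + 2 ^ j * w i)))"
proof -
  let ?Q = "\<lambda>w b p. 3 \<le> b \<and> b \<le> 5 \<and> p \<in> S \<and> enorm n p = r \<and> w = (\<lambda>i. b * p i - v i)"
  have "\<forall>w\<in>{w \<in> S. enorm n w \<le> r}. \<exists>b p. ?Q w b p"
    using ball_from_sphere[OF S r v] by blast
  then obtain b where "\<forall>w\<in>{w \<in> S. enorm n w \<le> r}. \<exists>p. ?Q w (b w) p"
    by (rule bchoice[THEN exE])
  then obtain p where "\<forall>w\<in>{w \<in> S. enorm n w \<le> r}. ?Q w (b w) (p w)"
    by (rule bchoice[THEN exE])
  then have bp': "?Q w (b w) (p w)" if "w \<in> S" "enorm n w \<le> r" for w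
    by (rule bspec) (use that in simp)
  have bp: "3 \<le> b w" "b w \<le> 5" "p w \<in> S" "enorm n (p w) = r" "\<And>i. w i = b w * p w i - v i"
    if "w \<in> S" "enorm n w \<le> r" for w
  proof -
    note * = bp'[OF that]
    show "3 \<le> b w" by (rule conjunct1[OF *])
    show "b w \<le> 5" by (rule conjunct1[OF conjunct2[OF *]])
    show "p w \<in> S" by (rule conjunct1[OF conjunct2[OF conjunct2[OF *]]])
    show "enorm n (p w) = r" by (rule conjunct1[OF conjunct2[OF conjunct2[OF conjunct2[OF *]]]])
    have "w = (\<lambda>i. b w * p w i - v i)" by (rule conjunct2[OF conjunct2[OF conjunct2[OF conjunct2[OF *]]]])
    then show "w i = b w * p w i - v i" for i by (rule fun_cong)
  qed
  \<comment> \<open>\<open>b\<close> is rounded to multiples of 1/20, leaving the 41 integers from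
    60 to 100, and \<open>p\<close> is replaced by its vertex at level \<open>s0\<close>.\<close>
  define \<phi> where "\<phi> = (\<lambda>w. (\<lfloor>20 * b w\<rfloor>, \<pi> s0 (p w)))"
  define F where "F = {60..100 :: int} \<times> Ts s0"
  have "finite F" by (simp add: F_def Ts_finite)
  moreover have "card F \<le> 41 * 2 ^ (2 ^ s0)" using Ts_card[of s0] by (simp add: F_def card_cartesian_product)
  moreover have "\<phi> w \<in> F" if "w \<in> S" "enorm n w \<le> r" for w
    using bp(1-4)[OF that] pi_in[of "p w" s0] by (auto simp: \<phi>_def F_def le_floor_iff floor_le_iff)
  moreover have "enorm n (\<lambda>i. w i - w' i) \<le> r / 2"
    if w: "w \<in> S" "enorm n w \<le> r" and w': "w' \<in> S" "enorm n w' \<le> r" and eq: "\<phi> w = \<phi> w'" for w w'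
  proof -
    note 1 = bp(1-4)[OF w] and 2 = bp(1-4)[OF w']
    have fl: "\<lfloor>20 * b w\<rfloor> = \<lfloor>20 * b w'\<rfloor>" and pi: "\<pi> s0 (p w) = \<pi> s0 (p w')"
      using eq by (auto simp: \<phi>_def)
    have bb: "\<bar>b w - b w'\<bar> \<le> 1/20" using fl by linarith
    \<comment> \<open>The bound on \<open>N\<close> gives that \<open>sqrt N\<close> is at most
      \<open>16 * 2 powr (s0 / 2)\<close>, so dividing \<open>G\<close> by the chaining weight
      leaves \<open>16 / 1000 * r\<close>.\<close>
    have near: "edist n (p x) (\<pi> s0 (p x)) \<le> 0.016 * r" if "x \<in> S" "enorm n x \<le> r" for x
    proof -
      note 3 = bp(1-4)[OF that]
      have "sqrt (real N) \<le> sqrt (256 * 2 ^ s0)"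
        using of_nat_mono[OF less_imp_le[OF s0(2)], where 'a = real] by (intro real_sqrt_le_mono) simp
      also have "\<dots> = 16 * 2 powr (real s0 / 2)"
        by (simp add: real_sqrt_mult powr_half_sqrt[symmetric] powr_realpow[symmetric] powr_powr)
      finally have "G \<le> r * (16 * 2 powr (real s0 / 2)) / 1000"
        using r by (simp add: G divide_right_mono)
      also have "\<dots> = 2 powr (real s0 / 2) * (0.016 * r)" by simp
      finally have "2 powr (real s0 / 2) * a s0 (p x) \<le> 2 powr (real s0 / 2) * (0.016 * r)"
        using a_le[OF 3(3,4), of s0] by linarith
      then have "a s0 (p x) \<le> 0.016 * r" by (simp add: mult_le_cancel_left_pos)
      then show ?thesis using edist_pi_le[of "p x" s0] 3 by linarith
    qed
    have pp: "enorm n (\<lambda>i. p w i - p w' i) \<le> 0.032 * r"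
      using enorm_diff[of n "\<lambda>i. p w i - \<pi> s0 (p w) i" "\<lambda>i. p w' i - \<pi> s0 (p w') i"]
        near[OF w] near[OF w'] by (simp add: edist_def pi)
    have "w i - w' i = (b w - b w') * p w i + b w' * (p w i - p w' i)" for i
    proof -
      have "w i - w' i = (b w * p w i - v i) - (b w' * p w' i - v i)"
        by (rule arg_cong2[OF bp(5)[OF w] bp(5)[OF w']])
      also have "\<dots> = (b w - b w') * p w i + b w' * (p w i - p w' i)" by (simp add: algebra_simps)
      finally show ?thesis .
    qed
    then have weq: "(\<lambda>i. w i - w' i) = (\<lambda>i. (b w - b w') * p w i + b w' * (p w i - p w' i))"
      by (rule ext)
    have "enorm n (\<lambda>i. w i - w' i)
        \<le> enorm n (\<lambda>i. (b w - b w') * p w i) + enorm n (\<lambda>i. b w' * (p w i - p w' i))"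
      by (subst weq) (rule enorm_add)
    also have "\<dots> = \<bar>b w - b w'\<bar> * r + \<bar>b w'\<bar> * enorm n (\<lambda>i. p w i - p w' i)"
      using 1 by (simp only: enorm_scale)
    \<comment> \<open>The cell diameter is at most \<open>0.21 * r\<close>, within the
      \<open>r / 2\<close> required by \<open>iterated_net\<close>.\<close>
    also have "\<dots> \<le> 1/20 * r + 5 * (0.032 * r)"
      using bb pp 2 r by (intro add_mono mult_mono) auto
    also have "\<dots> \<le> r / 2" using r by simp
    finally show ?thesis .
  qed
  ultimately have F: "finite F" "card F \<le> 41 * 2 ^ (2 ^ s0)" and "\<exists>Z. finite Z \<and> card Z \<le> card F ^ j \<and>
      (\<forall>t\<in>S. enorm n t \<le> 4 ^ j * r \<longrightarrow> (\<exists>z\<in>Z. \<exists>w\<in>S. enorm n w \<le> r \<and> t = (\<lambda>i. z i + 2 ^ j * w i)))"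
    by (blast, blast, intro iterated_net[OF S r, of F n \<phi>])
  moreover have "card F ^ j \<le> (41 * 2 ^ (2 ^ s0)) ^ j"
    using F(2) by (intro power_mono) auto
  ultimately show ?thesis by (meson order_trans)
qed

text \<open>Since \<open>t\<close> is in the kernel, \<open>ip n (X i) z\<close> equals
  \<open>- 16 ^ l * ip n (X i) w\<close>. Writing \<open>w\<close> through points of norm
  \<open>r\<close> bounds this by \<open>18 * 64 ^ l * r\<close> for at least half of the indices,
  whereas \<open>z\<close> has norm at least \<open>256 ^ l * r / 2\<close>. That is too many small
  values for \<open>small\<close>.\<close>

lemma no_kernel_point:
  assumes l: "20 \<le> l" and v: "v \<in> S" "enorm n v = 4 * r"
    and t: "t \<in> S" "enorm n t = 256 ^ l * r" "\<And>i. i < N \<Longrightarrow> ip n (X i) t = 0"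
    and net: "w \<in> S" "enorm n w \<le> r" "t = (\<lambda>i. z i + 2 ^ (4 * l) * w i)"
    and large: "\<And>p. p \<in> S \<Longrightarrow> enorm n p = r \<Longrightarrow> 4 * card {i. i < N \<and> 2 * 4 ^ l * r < \<bar>ip n (X i) p\<bar>} \<le> N"
    and small: "enorm n z > 0 \<Longrightarrow>
      card {i. i < N \<and> \<bar>ip n (X i) z\<bar> \<le> enorm n z / 4 ^ (l - 3)} < (N + 1) div 2"
  shows False
proof -
  obtain b p where bp: "3 \<le> b" "b \<le> 5" "p \<in> S" "enorm n p = r" "w = (\<lambda>i. b * p i - v i)"
    using ball_from_sphere[OF S r v net(1,2)] by blast
  \<comment> \<open>\<open>v\<close> has norm \<open>4 * r\<close>; rescaled to norm
    \<open>r\<close> it falls under \<open>large\<close>, so that \<open>w\<close> is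
    \<open>b * p - 4 * p0\<close>.\<close>
  define p0 where "p0 = (\<lambda>i. 1/4 * v i)"
  have p0: "p0 \<in> S" "enorm n p0 = r"
    using sym_convex_scale[OF S v(1), of "1/4"] enorm_scale[of n "1/4" v] v(2) by (auto simp: p0_def)
  have p16: "(2::real) ^ (4 * l) = 16 ^ l" by (simp add: power_mult)
  have p256: "(256::real) ^ l = 16 ^ l * 16 ^ l" "(256::real) ^ l = 64 ^ l * 4 ^ l" "(64::real) ^ l = 16 ^ l * 4 ^ l"
    by (simp_all add: power_mult_distrib[symmetric])
  have nz: "256 ^ l * r / 2 \<le> enorm n z"
  proof -
    have "z = (\<lambda>i. t i - 16 ^ l * w i)" using net(3) by (simp add: fun_eq_iff p16)
    then have "enorm n t - 16 ^ l * enorm n w \<le> enorm n z"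
      using enorm_diff_ge[of n t "\<lambda>i. 16 ^ l * w i"] by (simp add: enorm_scale)
    moreover have "16 ^ l * enorm n w \<le> 16 ^ l * r" using net(2) by simp
    moreover have "2 * 16 ^ l * r \<le> 256 ^ l * r"
    proof -
      have "(16::real) ^ 1 \<le> 16 ^ l" using l by (intro power_increasing) auto
      then have "2 * 16 ^ l \<le> (256::real) ^ l" unfolding p256(1) by simp
      then show ?thesis using r by simp
    qed
    ultimately show ?thesis using t(2) by linarith
  qed
  have z0: "enorm n z > 0" using nz r by (smt (verit) zero_less_power divide_pos_pos mult_pos_pos)
  let ?bad = "\<lambda>p. {i. i < N \<and> 2 * 4 ^ l * r < \<bar>ip n (X i) p\<bar>}"
  have "{..<N} - (?bad p \<union> ?bad p0) \<subseteq> {i. i < N \<and> \<bar>ip n (X i) z\<bar> \<le> enorm n z / 4 ^ (l - 3)}"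
  proof
    fix i assume i: "i \<in> {..<N} - (?bad p \<union> ?bad p0)"
    have v4: "ip n (X i) v = 4 * ip n (X i) p0" unfolding p0_def ip_scale by simp
    have "0 = ip n (X i) z + 16 ^ l * ip n (X i) w"
      using t(3)[of i] i by (simp add: net(3) ip_add ip_scale p16)
    moreover have "ip n (X i) w = b * ip n (X i) p - 4 * ip n (X i) p0"
      by (simp add: bp(5) ip_diff ip_scale v4)
    ultimately have "\<bar>ip n (X i) z\<bar> = 16 ^ l * \<bar>b * ip n (X i) p - 4 * ip n (X i) p0\<bar>"
      by (metis abs_minus_cancel abs_mult abs_of_nonneg add_eq_0_iff zero_le_numeral zero_le_power)
    also have "\<dots> \<le> 16 ^ l * (18 * (4 ^ l * r))"
    proof (intro mult_left_mono)
      have "\<bar>b * ip n (X i) p - 4 * ip n (X i) p0\<bar> \<le> \<bar>b\<bar> * \<bar>ip n (X i) p\<bar> + 4 * \<bar>ip n (X i) p0\<bar>"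
        by (metis abs_triangle_ineq4 abs_mult abs_numeral)
      \<comment> \<open>Outside both bad sets each inner product is at most
        \<open>2 * 4 ^ l * r\<close>, and the coefficients sum to at most 9.\<close>
      also have "\<dots> \<le> 5 * (2 * 4 ^ l * r) + 4 * (2 * 4 ^ l * r)"
        using i bp r by (intro add_mono mult_mono) auto
      also have "\<dots> = 18 * (4 ^ l * r)" by simp
      finally show "\<bar>b * ip n (X i) p - 4 * ip n (X i) p0\<bar> \<le> 18 * (4 ^ l * r)" .
    qed simp
    also have "\<dots> \<le> enorm n z / 4 ^ (l - 3)"
    proof -
      have "(4::real) ^ l = 4 ^ (l - 3) * 64"
        using l power_add[of "4::real" "l - 3" 3] by simp
      then have "16 ^ l * (18 * (4 ^ l * r)) * 4 ^ (l - 3) = 18 / 64 * (256 ^ l * r)"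
        unfolding p256(2,3) by simp
      also have "\<dots> \<le> 1 / 2 * (256 ^ l * r)" using r by (intro mult_right_mono) auto
      also have "\<dots> \<le> enorm n z" using nz by simp
      finally show ?thesis by (simp add: field_simps)
    qed
    finally show "i \<in> {i. i < N \<and> \<bar>ip n (X i) z\<bar> \<le> enorm n z / 4 ^ (l - 3)}" using i by simp
  qed
  then have "card ({..<N} - (?bad p \<union> ?bad p0)) \<le> card {i. i < N \<and> \<bar>ip n (X i) z\<bar> \<le> enorm n z / 4 ^ (l - 3)}"
    by (intro card_mono) auto
  moreover have "N - card (?bad p \<union> ?bad p0) \<le> card ({..<N} - (?bad p \<union> ?bad p0))"
    using diff_card_le_card_Diff[of "?bad p \<union> ?bad p0" "{..<N}"] by simp
  moreover have "card (?bad p \<union> ?bad p0) \<le> card (?bad p) + card (?bad p0)" by (rule card_Un_le)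
  ultimately show False
    using large[OF bp(3,4)] large[OF p0] small[OF z0] by linarith
qed

text \<open>Combines the three exceptional events, whose bounds are 1, 2 and 1 times
  \<open>(1/2) ^ (10 * l)\<close>. If \<open>S\<close> reaches norm \<open>256 ^ l * r\<close>,
  shrinking such a point gives the \<open>v\<close> of norm \<open>4 * r\<close> from which the
  covering is built.\<close>

lemma fails_le_scale:
  assumes l: "20 \<le> l"
  shows "fails_le M (4 * (1/2) ^ (10 * l))
    (\<lambda>X. \<not> (\<exists>t\<in>S. enorm n t = 256 ^ l * r \<and> (\<forall>i<N. ip n (X i) t = 0)))"
proof (cases "\<exists>t\<in>S. enorm n t = 256 ^ l * r")
  case False
  then show ?thesis by (intro fails_leI[of "{}"]) auto
next
  case True
  then obtain t0 where t0: "t0 \<in> S" "enorm n t0 = 256 ^ l * r" by blast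
  define v where "v = (\<lambda>i. 4 / 256 ^ l * t0 i)"
  have "(256::real) ^ 1 \<le> 256 ^ l" using l by (intro power_increasing) auto
  then have v: "v \<in> S" "enorm n v = 4 * r"
    using sym_convex_scale[OF S t0(1), of "4 / 256 ^ l"] enorm_scale[of n "4 / 256 ^ l" t0] t0(2)
    by (auto simp: v_def)
  \<comment> \<open>The net is fixed before the samples are, as the union bound requires. The choice
    \<open>4 * l\<close> matches \<open>4 ^ (4 * l)\<close> with \<open>256 ^ l\<close>.\<close>
  obtain Z where Z: "finite Z" "card Z \<le> (41 * 2 ^ (2 ^ s0)) ^ (4 * l)"
    and net: "\<And>t. t \<in> S \<Longrightarrow> enorm n t \<le> 4 ^ (4 * l) * r \<Longrightarrow>
       \<exists>z\<in>Z. \<exists>w\<in>S. enorm n w \<le> r \<and> t = (\<lambda>i. z i + 2 ^ (4 * l) * w i)"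
    using covering_net[OF v, of "4 * l"] by blast
  show ?thesis
  proof (rule fails_le_mono[OF fails_le_conj[OF fails_le_vertices[OF l]
            fails_le_conj[OF fails_le_chain[OF l] fails_le_net[OF l Z]]]])
    fix X
    assume X: "(\<forall>u\<in>Ts s0. card {i. i < N \<and> 4 ^ l * r < \<bar>ip n (X i) u\<bar>} < N div 8 + 1) \<and>
      (\<forall>k. \<forall>(u, v)\<in>Ts (s0 + k) \<times> Ts (Suc (s0 + k)). psi2_dist n \<mu> u v < top \<longrightarrow>
        L2_set (\<lambda>i. ip n (X i) (\<lambda>j. u j - v j)) {..<N}
          \<le> 2 * enn2real (psi2_dist n \<mu> u v) * sqrt (real ((260 + l) * 2 ^ (s0 + k)))) \<and>
      (\<forall>z\<in>Z. enorm n z > 0 \<longrightarrow>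
        card {i. i < N \<and> \<bar>ip n (X i) z\<bar> \<le> enorm n z / 4 ^ (l - 3)} < (N + 1) div 2)"
    have large: "4 * card {i. i < N \<and> 2 * 4 ^ l * r < \<bar>ip n (X i) p\<bar>} \<le> N"
      if p: "p \<in> S" "enorm n p = r" for p
    proof (rule card_large_le[OF p])
      show "card {i. i < N \<and> 4 ^ l * r < \<bar>ip n (X i) (\<pi> s0 p)\<bar>} < N div 8 + 1"
        using X pi_in[OF p] by blast
      show "L2_set (\<lambda>i. ip n (X i) (\<lambda>j. p j - \<pi> s0 p j)) {..<N} \<le> 8 * sqrt (260 + real l) * G"
      proof (rule chain_remainder[OF p])
        fix k u v assume "u \<in> Ts (s0 + k)" "v \<in> Ts (Suc (s0 + k))" "psi2_dist n \<mu> u v < top"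
        then have "L2_set (\<lambda>i. ip n (X i) (\<lambda>j. u j - v j)) {..<N}
          \<le> 2 * enn2real (psi2_dist n \<mu> u v) * sqrt (real ((260 + l) * 2 ^ (s0 + k)))"
          using X by blast
        then show "L2_set (\<lambda>i. ip n (X i) (\<lambda>j. u j - v j)) {..<N}
          \<le> 2 * enn2real (psi2_dist n \<mu> u v) * sqrt ((260 + real l) * 2 ^ (s0 + k))"
          by simp
      qed simp
    qed
    show "\<not> (\<exists>t\<in>S. enorm n t = 256 ^ l * r \<and> (\<forall>i<N. ip n (X i) t = 0))"
    proof safe
      fix t assume t: "t \<in> S" "enorm n t = 256 ^ l * r" "\<forall>i<N. ip n (X i) t = 0"
      have "(4::real) ^ (4 * l) = 256 ^ l" by (simp add: power_mult)
      then obtain z w where zw: "z \<in> Z" "w \<in> S" "enorm n w \<le> r" "t = (\<lambda>i. z i + 2 ^ (4 * l) * w i)"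
        using net[OF t(1)] t(2) by auto
      show False
        by (rule no_kernel_point[OF l v t(1,2) _ zw(2,3,4) large]) (use X zw t(3) in auto)
    qed
  qed auto
qed

end

text \<open>Dropping the extensionality convention of \<^const>\<open>Rn\<close> makes convex combinations of points
  of \<open>K\<close> plain pointwise combinations of functions.\<close>
definition saturation :: "nat \<Rightarrow> (nat \<Rightarrow> real) set \<Rightarrow> (nat \<Rightarrow> real) set" where
  "saturation n K = {x. restrict x {..<n} \<in> K}"

lemma saturation_superset: "K \<subseteq> Rn n \<Longrightarrow> K \<subseteq> saturation n K"
  by (auto simp: saturation_def Rn_def PiE_def extensional_restrict)

lemma sym_convex_saturation:
  assumes "convex_body n K"
  shows "sym_convex (saturation n K)"
  unfolding sym_convex_def
proof (intro conjI ballI allI impI)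
  fix x y :: "nat \<Rightarrow> real" and t :: real
  assume x: "x \<in> saturation n K" and y: "y \<in> saturation n K" and t: "0 \<le> t \<and> t \<le> 1"
  have "restrict (\<lambda>i. t * restrict x {..<n} i + (1 - t) * restrict y {..<n} i) {..<n} \<in> K"
    using assms x y t unfolding convex_body_def saturation_def by blast
  moreover have "restrict (\<lambda>i. t * restrict x {..<n} i + (1 - t) * restrict y {..<n} i) {..<n}
      = restrict (\<lambda>i. t * x i + (1 - t) * y i) {..<n}"
    by (rule restrict_ext) simp
  ultimately show "(\<lambda>i. t * x i + (1 - t) * y i) \<in> saturation n K" by (simp add: saturation_def)
next
  fix x :: "nat \<Rightarrow> real"
  assume "x \<in> saturation n K"
  then have "neg_vec n (restrict x {..<n}) \<in> K"
    using assms unfolding convex_body_def saturation_def by blast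
  moreover have "neg_vec n (restrict x {..<n}) = restrict (\<lambda>i. - x i) {..<n}"
    unfolding neg_vec_def by (rule restrict_ext) simp
  ultimately show "(\<lambda>i. - x i) \<in> saturation n K" by (simp add: saturation_def)
qed

section \<open>Expected diameter\<close>

text \<open>The events \<open>D\<close> are replaced by measurable exceptional sets
  \<open>B k\<close>, which makes termwise integration possible. The weights grow by 256 per scale
  and the probabilities shrink by 1024, leaving a geometric series of ratio 1/4.\<close>

lemma nn_integral_le_scale_series:
  fixes f :: "'a \<Rightarrow> ennreal"
  assumes "prob_space M" and r: "r > 0"
    and fails: "\<And>l. 20 \<le> l \<Longrightarrow> fails_le M (4 * (1/2) ^ (10 * l)) (\<lambda>X. \<not> D l X)"
    and f: "\<And>X. X \<in> space M \<Longrightarrow> f X \<le> ennreal (256 ^ 20 * r) + (\<Sum>k. ennreal (256 ^ (k + 21) * r) * of_bool (D (k + 20) X))"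
  shows "(\<integral>\<^sup>+X. f X \<partial>M) \<le> ennreal ((256 ^ 20 + 2048) * r)"
proof -
  interpret prob_space M by fact
  have "\<exists>B\<in>sets M. emeasure M B \<le> ennreal (4 * (1/2) ^ (10 * (k + 20))) \<and> (\<forall>X\<in>space M - B. \<not> D (k + 20) X)" for k
    using fails[of "k + 20"] unfolding fails_le_def by simp
  then obtain B where B: "\<And>k. B k \<in> sets M" "\<And>k. emeasure M (B k) \<le> ennreal (4 * (1/2) ^ (10 * (k + 20)))"
    "\<And>k X. X \<in> space M \<Longrightarrow> X \<notin> B k \<Longrightarrow> \<not> D (k + 20) X"
    by (metis DiffI)
  note [measurable] = B(1)
  have "(\<integral>\<^sup>+X. f X \<partial>M) \<le> (\<integral>\<^sup>+X. ennreal (256 ^ 20 * r) + (\<Sum>k. ennreal (256 ^ (k + 21) * r) * indicator (B k) X) \<partial>M)"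
  proof (rule nn_integral_mono)
    fix X assume X: "X \<in> space M"
    have "(\<Sum>k. ennreal (256 ^ (k + 21) * r) * of_bool (D (k + 20) X)) \<le> (\<Sum>k. ennreal (256 ^ (k + 21) * r) * indicator (B k) X)"
      using B(3)[OF X] by (intro suminf_le mult_left_mono) (auto simp: indicator_def of_bool_def)
    then show "f X \<le> ennreal (256 ^ 20 * r) + (\<Sum>k. ennreal (256 ^ (k + 21) * r) * indicator (B k) X)"
      using f[OF X] by (meson add_left_mono order_trans)
  qed
  also have "\<dots> = ennreal (256 ^ 20 * r) + (\<Sum>k. ennreal (256 ^ (k + 21) * r) * emeasure M (B k))"
    by (simp add: nn_integral_add nn_integral_suminf nn_integral_cmult_indicator emeasure_space_1 del: power_Suc)
  also have "\<dots> \<le> ennreal (256 ^ 20 * r) + (\<Sum>k. ennreal (1024 * r * (1/4) ^ k))"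
  proof (intro add_left_mono suminf_le)
    fix k
    have "ennreal (256 ^ (k + 21) * r) * emeasure M (B k)
        \<le> ennreal (256 ^ (k + 21) * r) * ennreal (4 * (1/2) ^ (10 * (k + 20)))"
      by (intro mult_left_mono B) auto
    also have "\<dots> = ennreal (256 ^ (k + 21) * r * (4 * (1/2) ^ (10 * (k + 20))))"
      using r by (intro ennreal_mult[symmetric]) auto
    also have "256 ^ (k + 21) * r * (4 * (1/2) ^ (10 * (k + 20))) = 1024 * r * (256 * (1/2) ^ 10) ^ (k + 20)"
      by (simp only: power_mult power_mult_distrib power_add) simp
    also have "\<dots> \<le> 1024 * r * (1/4) ^ k"
    proof -
      have "(256 * (1/2) ^ 10 :: real) = 1/4" by (simp add: power_divide)
      moreover have "(1/4 :: real) ^ (k + 20) \<le> (1/4) ^ k" by (intro power_decreasing) auto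
      ultimately show ?thesis using r by (simp only:) (intro mult_left_mono, auto)
    qed
    finally show "ennreal (256 ^ (k + 21) * r) * emeasure M (B k) \<le> ennreal (1024 * r * (1/4) ^ k)"
      by (simp add: ennreal_leI)
  qed auto
  also have "(\<Sum>k. ennreal (1024 * r * (1/4) ^ k)) = ennreal (1024 * r * (4/3))"
  proof -
    have "(\<lambda>k. 1024 * r * (1/4) ^ k) sums (1024 * r * (4/3))"
      using sums_mult[OF geometric_sums[of "1/4 :: real"], of "1024 * r"] by simp
    then show ?thesis using r by (intro suminf_ennreal_eq) auto
  qed
  also have "ennreal (256 ^ 20 * r) + ennreal (1024 * r * (4/3)) = ennreal (256 ^ 20 * r + 1024 * r * (4/3))"
    using r by (intro ennreal_plus[symmetric]) auto
  also have "\<dots> \<le> ennreal ((256 ^ 20 + 2048) * r)"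
    using r by (intro ennreal_leI) (simp add: distrib_right)
  finally show ?thesis .
qed

text \<open>A kernel point with norm between two consecutive scales can be shrunk to the lower one
  inside both \<open>S\<close> and the kernel, so the event at that scale occurs while the upper
  scale bounds the norm. Hence the weight has exponent \<open>k + 21\<close> and the event index
  \<open>k + 20\<close>.\<close>

lemma ediam_kernel_section_le:
  assumes S: "sym_convex S" and K: "K \<subseteq> S" and r: "r > 0"
  shows "ediam n (K \<inter> ker_Gamma n N X) \<le> ennreal (256 ^ 20 * (2 * r)) + (\<Sum>k. ennreal (256 ^ (k + 21) * (2 * r)) *
     of_bool (\<exists>t\<in>S. enorm n t = 256 ^ (k + 20) * r \<and> (\<forall>i<N. ip n (X i) t = 0)))"
proof -
  let ?D = "\<lambda>l. \<exists>t\<in>S. enorm n t = 256 ^ l * r \<and> (\<forall>i<N. ip n (X i) t = 0)"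
  let ?R = "ennreal (256 ^ 20 * r) + (\<Sum>k. ennreal (256 ^ (k + 21) * r) * of_bool (?D (k + 20)))"
  have norm: "ennreal (enorm n x) \<le> ?R" if x: "x \<in> K" "x \<in> ker_Gamma n N X" for x
  proof (cases "enorm n x \<le> 256 ^ 20 * r")
    case True
    then show ?thesis by (intro add_increasing2 ennreal_leI) auto
  next
    case False
    obtain j0 where "enorm n x / r < 256 ^ j0" using real_arch_pow[of 256 "enorm n x / r"] by auto
    then have ex: "enorm n x < 256 ^ j0 * r" using r by (simp add: field_simps)
    define j where "j = (LEAST j. enorm n x < 256 ^ j * r)"
    have j: "enorm n x < 256 ^ j * r" unfolding j_def by (rule LeastI[of _ j0]) (rule ex)
    have "\<not> j \<le> 20"
    proof
      assume "j \<le> 20"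
      then have "(256::real) ^ j * r \<le> 256 ^ 20 * r" using r by (intro mult_right_mono power_increasing) auto
      then show False using j False by linarith
    qed
    then obtain k where k: "j = Suc (k + 20)" by (metis add.commute less_natE not_le add_Suc_right)
    have "\<not> enorm n x < 256 ^ (k + 20) * r"
      using not_less_Least[of "k + 20" "\<lambda>j. enorm n x < 256 ^ j * r"] k unfolding j_def by linarith
    then have ge: "256 ^ (k + 20) * r \<le> enorm n x" by simp
    define c where "c = 256 ^ (k + 20) * r / enorm n x"
    have rk: "0 < 256 ^ (k + 20) * r" using r by simp
    then have x0: "enorm n x > 0" using ge by linarith
    then have c: "0 < c" "c \<le> 1" using rk ge unfolding c_def by (auto simp only: divide_pos_pos divide_le_eq_1_pos)
    have "(\<lambda>i. c * x i) \<in> S" using x(1) K c by (intro sym_convex_scale[OF S]) auto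
    moreover have "enorm n (\<lambda>i. c * x i) = 256 ^ (k + 20) * r"
    proof -
      have "enorm n (\<lambda>i. c * x i) = c * enorm n x" using c by (simp add: enorm_scale)
      also have "\<dots> = 256 ^ (k + 20) * r" using x0 unfolding c_def by simp
      finally show ?thesis .
    qed
    moreover have "\<forall>i<N. ip n (X i) (\<lambda>j. c * x j) = 0"
      using x(2) by (simp add: ker_Gamma_def ip_scale)
    ultimately have D: "?D (k + 20)" by blast
    have "j = k + 21" using k by simp
    with j have "ennreal (enorm n x) \<le> ennreal (256 ^ (k + 21) * r)"
      by (intro ennreal_leI) (simp only: less_imp_le)
    also have "\<dots> = ennreal (256 ^ (k + 21) * r) * of_bool (?D (k + 20))"
      by (simp only: D of_bool_eq mult_1_right)
    also have "\<dots> \<le> (\<Sum>k. ennreal (256 ^ (k + 21) * r) * of_bool (?D (k + 20)))"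
    proof -
      have "g k \<le> (\<Sum>k. g k)" for g :: "nat \<Rightarrow> ennreal" using sum_le_suminf[of g "{k}"] by simp
      then show ?thesis .
    qed
    finally show ?thesis by (intro add_increasing) auto
  qed
  have double: "ennreal (256 ^ m * (2 * r)) = ennreal (256 ^ m * r) + ennreal (256 ^ m * r)" for m
    using r by (subst ennreal_plus[symmetric]) (auto simp: algebra_simps)
  \<comment> \<open>The diameter is at most twice the largest norm; this doubles the radius in the
    weights but leaves it unchanged in the events.\<close>
  have R: "?R + ?R = ennreal (256 ^ 20 * (2 * r)) + (\<Sum>k. ennreal (256 ^ (k + 21) * (2 * r)) * of_bool (?D (k + 20)))"
    unfolding double distrib_right suminf_add[OF summableI summableI, symmetric] by (simp only: ac_simps)
  show ?thesis unfolding ediam_def R[symmetric]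
  proof (intro SUP_least)
    fix x y assume x: "x \<in> K \<inter> ker_Gamma n N X" and y: "y \<in> K \<inter> ker_Gamma n N X"
    have "ennreal (edist n x y) \<le> ennreal (enorm n x + enorm n y)"
      unfolding edist_def by (intro ennreal_leI enorm_diff)
    also have "\<dots> = ennreal (enorm n x) + ennreal (enorm n y)" by (simp add: ennreal_plus)
    also have "\<dots> \<le> ?R + ?R" using x y by (intro add_mono norm) auto
    finally show "ennreal (edist n x y) \<le> ?R + ?R" .
  qed
qed

context iso_log_concave
begin

text \<open>Sets up \<open>chained_section\<close> from the \<open>gamma2\<close> hypothesis. If
  \<open>K\<close> has no point of norm \<open>r\<close>, then by scaling its saturation has none of
  norm \<open>256 ^ l * r\<close>.\<close>

lemma fails_le_kernel_point:
  assumes body: "convex_body n K" and r: "r > 0" and N1: "1 \<le> N"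
    and gam: "gamma2 (K \<inter> esphere n r) (psi2_dist n \<mu>) / ennreal (sqrt (real N)) \<le> ennreal (1/2000 * r)"
    and l: "20 \<le> l"
  shows "fails_le (PiM {..<N} (\<lambda>_. \<mu>)) (4 * (1/2) ^ (10 * l))
    (\<lambda>X. \<not> (\<exists>t\<in>saturation n K. enorm n t = 256 ^ l * r \<and> (\<forall>i<N. ip n (X i) t = 0)))"
proof -
  define S where "S = saturation n K"
  define T where "T = K \<inter> esphere n r"
  have S: "sym_convex S" unfolding S_def by (rule sym_convex_saturation[OF body])
  have KRn: "K \<subseteq> Rn n" using body by (simp add: convex_body_def)
  have restr: "restrict p {..<n} \<in> T" if "p \<in> S" "enorm n p = r" for p
  proof -
    have "enorm n (restrict p {..<n}) = enorm n p" by (rule enorm_cong) auto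
    then show ?thesis using that by (auto simp: T_def S_def saturation_def esphere_def Rn_def)
  qed
  have dist_restr: "psi2_dist n \<mu> (restrict p {..<n}) u = psi2_dist n \<mu> p u" for p u
  proof -
    have "ip n (\<lambda>i. restrict p {..<n} i - u i) z = ip n (\<lambda>i. p i - u i) z" for z by (rule ip_cong) auto
    then show ?thesis by (simp add: psi2_dist_def)
  qed
  show ?thesis
  proof (cases "T = {}")
    case True
    have "\<not> (\<exists>t\<in>S. enorm n t = 256 ^ l * r)"
    proof
      assume "\<exists>t\<in>S. enorm n t = 256 ^ l * r"
      then obtain t where t: "t \<in> S" "enorm n t = 256 ^ l * r" by blast
      have "(\<lambda>i. 1 / 256 ^ l * t i) \<in> S" by (rule sym_convex_scale[OF S t(1)]) simp
      moreover have "enorm n (\<lambda>i. 1 / 256 ^ l * t i) = r" unfolding enorm_scale t(2) by simp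
      ultimately show False using restr True by blast
    qed
    then show ?thesis unfolding S_def[symmetric] by (intro fails_leI[of "{}"]) auto
  next
    case False
    \<comment> \<open>Twice the bound that \<open>gam\<close> provides, so that the inequality
      needed by \<open>gamma2_chain\<close> is strict.\<close>
    define G where "G = r * sqrt (real N) / 1000"
    have sN: "sqrt (real N) > 0" using N1 by simp
    have "gamma2 T (psi2_dist n \<mu>) \<le> ennreal (1/2000 * r) * ennreal (sqrt (real N))"
    proof -
      have "gamma2 T (psi2_dist n \<mu>) = gamma2 T (psi2_dist n \<mu>) / ennreal (sqrt (real N)) * ennreal (sqrt (real N))"
        using sN by (subst ennreal_divide_times, subst ennreal_divide_self) simp_all
      also have "\<dots> \<le> ennreal (1/2000 * r) * ennreal (sqrt (real N))"
        using gam unfolding T_def by (intro mult_right_mono) auto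
      finally show ?thesis .
    qed
    also have "\<dots> = ennreal (1/2000 * r * sqrt (real N))" using r by (intro ennreal_mult[symmetric]) auto
    also have "\<dots> < ennreal G" using r sN by (intro ennreal_lessI) (auto simp: G_def)
    finally have gG: "gamma2 T (psi2_dist n \<mu>) < ennreal G" .
    show ?thesis
    proof (rule gamma2_chain[OF False gG])
      fix Ts \<pi> a
      assume Ts: "\<And>s. Ts s \<subseteq> T" "\<And>s. finite (Ts s)" "\<And>s. card (Ts s) \<le> 2 ^ (2 ^ s)" "card (Ts 0) = 1"
        and pi: "\<And>s t. t \<in> T \<Longrightarrow> \<pi> s t \<in> Ts s"
        and dist: "\<And>s t. t \<in> T \<Longrightarrow> psi2_dist n \<mu> t (\<pi> s t) = ennreal (a s t)"
        and a0: "\<And>s t. 0 \<le> a s t"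
        and asum: "\<And>m t. t \<in> T \<Longrightarrow> (\<Sum>s<m. 2 powr (real s / 2) * a s t) \<le> G"
      \<comment> \<open>\<open>T\<close> contains \<open>p\<close> and its reflection, at distance
        \<open>2 * r\<close>, and both are within \<open>G\<close> of the single point of
        \<open>Ts 0\<close>. Thus \<open>r\<close> is at most \<open>G\<close>.\<close>
      have "N \<ge> 1000000"
      proof -
        obtain p where p: "p \<in> T" using False by blast
        let ?q = "restrict (\<lambda>i. - p i) {..<n}"
        have q: "?q \<in> T"
        proof (rule restr)
          have "p \<in> S" using p saturation_superset[OF KRn] by (auto simp: T_def S_def)
          then show "(\<lambda>i. - p i) \<in> S" using S by (simp add: sym_convex_def)
          show "enorm n (\<lambda>i. - p i) = r" using p by (simp add: enorm_minus T_def esphere_def)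
        qed
        obtain u where "Ts 0 = {u}" using Ts(4) card_1_singletonE by blast
        then have u: "\<pi> 0 t = u" if "t \<in> T" for t using pi[OF that, of 0] by simp
        have near: "edist n t u \<le> G" if "t \<in> T" for t
        proof -
          have "ennreal (edist n t u) \<le> ennreal (a 0 t)"
            using edist_le_psi2_dist[of t u] dist[OF that, of 0] u[OF that] by simp
          then have "edist n t u \<le> a 0 t" using a0 by simp
          also have "\<dots> \<le> G" using asum[OF that, of 1] by simp
          finally show ?thesis .
        qed
        have "2 * r = enorm n (\<lambda>i. 2 * p i)" using p by (simp add: enorm_scale T_def esphere_def)
        also have "\<dots> = enorm n (\<lambda>i. (p i - u i) - (?q i - u i))" by (rule enorm_cong) auto
        also have "\<dots> \<le> edist n p u + edist n ?q u" unfolding edist_def by (rule enorm_diff)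
        also have "\<dots> \<le> G + G" by (intro add_mono near p q)
        finally have "r * 1000 \<le> r * sqrt (real N)" by (simp add: G_def)
        then have "1000 \<le> sqrt (real N)" using r by (simp add: mult_le_cancel_left_pos)
        then have "1000\<^sup>2 \<le> (sqrt (real N))\<^sup>2" by (intro power_mono) auto
        then show ?thesis by simp
      qed
      then have "1 \<le> N div 128" by simp
      then obtain s0 where "2 ^ s0 \<le> N div 128" "N div 128 < 2 ^ (s0 + 1)"
        using ex_power_ivl1[of 2 "N div 128"] by auto
      then have s0: "128 * 2 ^ s0 \<le> N" "N < 256 * 2 ^ s0" by auto
      \<comment> \<open>Composing with restriction extends the chaining maps from \<open>T\<close>
        to all points of \<open>S\<close> of norm \<open>r\<close>.\<close>
      interpret chained_section n \<mu> S r G N s0 Ts "\<lambda>s p. \<pi> s (restrict p {..<n})" "\<lambda>s p. a s (restrict p {..<n})"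
      proof unfold_locales
        show "enorm n u \<le> r" if "u \<in> Ts s" for s u
          using that Ts(1)[of s] by (auto simp: T_def esphere_def)
        show "psi2_dist n \<mu> p (\<pi> s (restrict p {..<n})) = ennreal (a s (restrict p {..<n}))"
          if "p \<in> S" "enorm n p = r" for s p
          using dist[OF restr[OF that], of s] by (simp add: dist_restr)
      qed (use S r Ts pi a0 asum restr s0 \<open>N \<ge> 1000000\<close> in \<open>auto simp: G_def\<close>)
      show ?thesis using fails_le_scale[OF l] by (simp only: S_def)
    qed
  qed
qed

lemma expected_diameter_le:
  assumes body: "convex_body n K" and r: "r > 0" and N1: "1 \<le> N"
    and gam: "gamma2 (K \<inter> esphere n r) (psi2_dist n \<mu>) / ennreal (sqrt (real N)) \<le> ennreal (1/2000 * r)"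
  shows "(\<integral>\<^sup>+X. ediam n (K \<inter> ker_Gamma n N X) \<partial>(PiM {..<N} (\<lambda>_. \<mu>)))
    \<le> ennreal (2 * (256 ^ 20 + 2048)) * ennreal r"
proof -
  let ?M = "PiM {..<N} (\<lambda>_. \<mu>)"
  let ?D = "\<lambda>l X. \<exists>t\<in>saturation n K. enorm n t = 256 ^ l * r \<and> (\<forall>i<N. ip n (X i) t = 0)"
  have KRn: "K \<subseteq> Rn n" using body by (simp add: convex_body_def)
  have "(\<integral>\<^sup>+X. ediam n (K \<inter> ker_Gamma n N X) \<partial>?M) \<le> ennreal ((256 ^ 20 + 2048) * (2 * r))"
  proof (rule nn_integral_le_scale_series)
    show "prob_space ?M" using prob_mu by (rule prob_space_PiM)
    show "fails_le ?M (4 * (1/2) ^ (10 * l)) (\<lambda>X. \<not> ?D l X)" if "20 \<le> l" for l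
      using assms that by (rule fails_le_kernel_point)
    show "ediam n (K \<inter> ker_Gamma n N X) \<le> ennreal (256 ^ 20 * (2 * r))
        + (\<Sum>k. ennreal (256 ^ (k + 21) * (2 * r)) * of_bool (?D (k + 20) X))" for X
      by (rule ediam_kernel_section_le[OF sym_convex_saturation[OF body] saturation_superset[OF KRn] r])
  qed (use r in simp)
  also have "\<dots> = ennreal (2 * (256 ^ 20 + 2048)) * ennreal r"
    using r by (subst ennreal_mult[symmetric]) (auto simp: mult_ac)
  finally show ?thesis .
qed

end

text \<open>Dividing by the positive \<open>c\<close> reduces this to a lower bound property; an
  empty \<open>A\<close> is covered, with infinite \<open>Inf A\<close>.\<close>

lemma ennreal_le_mult_Inf:
  assumes c: "c > 0" and le: "\<And>x. x \<in> A \<Longrightarrow> y \<le> ennreal c * x"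
  shows "y \<le> ennreal c * Inf A"
proof -
  have cancel: "x / ennreal c * ennreal c = x" for x
    using c by (subst ennreal_divide_times, subst ennreal_divide_self) simp_all
  have "y / ennreal c \<le> Inf A"
  proof (rule Inf_greatest)
    fix x assume "x \<in> A"
    then have "y / ennreal c \<le> ennreal c * x / ennreal c" by (intro divide_right_mono_ennreal le)
    also have "\<dots> = x" using c by (subst mult.commute, subst mult_divide_eq_ennreal) simp_all
    finally show "y / ennreal c \<le> x" .
  qed
  then have "y / ennreal c * ennreal c \<le> Inf A * ennreal c" by (rule mult_right_mono) simp
  then show ?thesis unfolding cancel by (simp only: mult.commute)
qed

text \<open>The witness \<open>1/2000\<close> for \<open>c\<close> is half of the factor 1/1000 in
  \<open>G\<close>. In \<open>c1\<close>, the term \<open>256 ^ 20\<close> is the first scale at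
  which kernel points are excluded, 2048 bounds the series over the larger scales, and the factor 2
  passes from norms to diameters.\<close>

theorem theorem6p3:
  shows "\<exists>c c1 :: real. c > 0 \<and> c1 > 0 \<and>
    (\<forall>(n::nat) (N::nat) (\<mu>::(nat \<Rightarrow> real) measure) (K::(nat \<Rightarrow> real) set).
       N \<ge> 1 \<and> prob_space \<mu> \<and> sets \<mu> = sets (Rn_borel n) \<and> symmetric_meas n \<mu>
       \<and> isotropic n \<mu> \<and> log_concave n \<mu> \<and> convex_body n K \<longrightarrow>
       (\<integral>\<^sup>+X. ediam n (K \<inter> ker_Gamma n N X) \<partial>(PiM {..<N} (\<lambda>_. \<mu>)))
         \<le> ennreal c1 * Inf {ennreal r | r. r > 0 \<and>
              gamma2 (K \<inter> esphere n r) (psi2_dist n \<mu>) / ennreal (sqrt (real N)) \<le> ennreal (c * r)})"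
proof (rule exI[of _ "1/2000"], rule exI[of _ "2 * (256 ^ 20 + 2048)"], intro conjI allI impI)
  fix n N :: nat and \<mu> :: "(nat \<Rightarrow> real) measure" and K :: "(nat \<Rightarrow> real) set"
  assume *: "N \<ge> 1 \<and> prob_space \<mu> \<and> sets \<mu> = sets (Rn_borel n) \<and> symmetric_meas n \<mu>
       \<and> isotropic n \<mu> \<and> log_concave n \<mu> \<and> convex_body n K"
  interpret iso_log_concave n \<mu> using * by (simp only: iso_log_concave_def)
  have N: "1 \<le> N" and body: "convex_body n K" using * by blast+
  show "(\<integral>\<^sup>+X. ediam n (K \<inter> ker_Gamma n N X) \<partial>(PiM {..<N} (\<lambda>_. \<mu>)))
      \<le> ennreal (2 * (256 ^ 20 + 2048)) * Inf {ennreal r | r. r > 0 \<and>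
         gamma2 (K \<inter> esphere n r) (psi2_dist n \<mu>) / ennreal (sqrt (real N)) \<le> ennreal (1/2000 * r)}"
  proof (rule ennreal_le_mult_Inf)
    fix x assume "x \<in> {ennreal r | r. r > 0 \<and>
         gamma2 (K \<inter> esphere n r) (psi2_dist n \<mu>) / ennreal (sqrt (real N)) \<le> ennreal (1/2000 * r)}"
    then obtain r where x: "x = ennreal r" and r: "r > 0"
      "gamma2 (K \<inter> esphere n r) (psi2_dist n \<mu>) / ennreal (sqrt (real N)) \<le> ennreal (1/2000 * r)"
      by blast
    show "(\<integral>\<^sup>+X. ediam n (K \<inter> ker_Gamma n N X) \<partial>(PiM {..<N} (\<lambda>_. \<mu>))) \<le> ennreal (2 * (256 ^ 20 + 2048)) * x"
      unfolding x by (rule expected_diameter_le[OF body r(1) N r(2)])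
  qed simp
qed (simp, simp)

end
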